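(* Let $q$ be an odd prime power, $t\ge5$ a positive integer and $s$ a positive integer with $\gcd(s,2t)=1$. If $t$ is odd and $q\ge7$, or $t$ is even and $q\ge5$, then there exists a pair $(m,h)$, admissible for $(q,t,s)$, such that for any positive integer $\ell$ with $\gcd(\ell,2t)=1$, for any $k\in\mathbb{F}_{q^{2t}}$ with $\mathrm{N}_{q^{2t}/q^t}(k)=-1$, and for any $\mu\in\mathbb{F}_{q^t}$ we have $$\psi_{1,k,\ell}\not\sim_{\mathrm{\Gamma L}}\psi_{m,h,s}\quad\text{and}\quad\psi_{m,h,s}\not\sim_{\mathrm{\Gamma L}}\psi_{\mu,1,\ell}.$$
   Context: Trace and norm: $\mathrm{Tr}_{q^{2t}/q^t}(x)=x+x^{q^t}$, $\mathrm{N}_{q^{2t}/q^t}(x)=x^{q^t+1}$. For a positive integer $s$ with $\gcd(s,2t)=1$ put $\mathscr{P}^+_s=\{w^{q^s+1}: w\in\ker\mathrm{Tr}_{q^{2t}/q^t}\}$ and $\mathscr{P}^-_s=\{w^{q^s-1}: w\in\ker\mathrm{Tr}_{q^{2t}/q^t}\}$ (subsets of $\mathbb{F}_{q^t}$). A pair $(m,h)\in\mathbb{F}_{q^t}^*\times\mathbb{F}_{q^{2t}}$ is called admissible for $(q,t,s)$ if one of the following holds: (i) [$t$ even, or $t$ odd and $q\equiv1\pmod4$] and $m\notin\mathscr{P}^+_s\cup\mathscr{P}^-_s$ and $\mathrm{N}_{q^{2t}/q^t}(h)=\pm1$; (ii)(a) $t$ odd, $q\equiv3\pmod4$, $m\in\mathscr{P}^+_s$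 and $\mathrm{N}_{q^{2t}/q^t}(h)=-1$; (ii)(b) $t$ odd, $q\equiv3\pmod4$, $m\notin\mathscr{P}^+_s\cup\mathscr{P}^-_s$, $\mathrm{N}_{q^{2t}/q^t}(h)=1$ and $h^2\neq-1$. For $m\in\mathbb{F}_{q^t}$, $h\in\mathbb{F}_{q^{2t}}^*$ and $s$ coprime to $2t$, $\psi_{m,h,s}= m(X^{q^s}-h^{1-q^{s(t+1)}}X^{q^{s(t+1)}})+X^{q^{s(t-1)}}+h^{1-q^{s(2t-1)}}X^{q^{s(2t-1)}}$, viewed as an $\mathbb{F}_q$-linear map of $\mathbb{F}_{q^{2t}}$ (exponents of $q$ taken modulo $2t$). For a linearized polynomial $f$ over $\mathbb{F}_{q^{2t}}$ let $U_f=\{(x,f(x)):x\in\mathbb{F}_{q^{2t}}\}$. Write $f\sim_{\mathrm{\Gamma L}}g$ if $U_f$ and $U_g$ lie in the same orbit of $\mathrm{\Gamma L}(2,q^{2t})$ (invertible semilinear maps of $\mathbb{F}_{q^{2t}}^2$). *)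

theory Defs
  imports
    "HOL-Library.Cardinality"
    "HOL-Library.Product_Plus"
    "HOL-Number_Theory.Prime_Powers"
begin

text \<open>
  The type variable \<open>'a\<close> plays the role of the field with \<open>q ^ (2 * t)\<close> elements; this
  cardinality is a hypothesis of the theorem and not part of the definitions.
  The following set is then the subfield with \<open>q ^ t\<close> elements.
\<close>

definition subfield_qt :: "nat \<Rightarrow> nat \<Rightarrow> 'a::{field,finite} set" where
  "subfield_qt q t = {x. x ^ (q ^ t) = x}"

definition Tr_qt :: "nat \<Rightarrow> nat \<Rightarrow> 'a::{field,finite} \<Rightarrow> 'a" where
  "Tr_qt q t x = x + x ^ (q ^ t)"

definition N_qt :: "nat \<Rightarrow> nat \<Rightarrow> 'a::{field,finite} \<Rightarrow> 'a" where
  "N_qt q t x = x ^ (q ^ t + 1)"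

definition ker_Tr :: "nat \<Rightarrow> nat \<Rightarrow> 'a::{field,finite} set" where
  "ker_Tr q t = {w. Tr_qt q t w = 0}"

definition P_plus :: "nat \<Rightarrow> nat \<Rightarrow> nat \<Rightarrow> 'a::{field,finite} set" where
  "P_plus q t s = {w ^ (q ^ s + 1) | w. w \<in> ker_Tr q t}"

definition P_minus :: "nat \<Rightarrow> nat \<Rightarrow> nat \<Rightarrow> 'a::{field,finite} set" where
  "P_minus q t s = {w ^ (q ^ s - 1) | w. w \<in> ker_Tr q t}"

definition admissible :: "nat \<Rightarrow> nat \<Rightarrow> nat \<Rightarrow> 'a::{field,finite} \<Rightarrow> 'a \<Rightarrow> bool" where
  "admissible q t s m h \<longleftrightarrow>
     m \<in> subfield_qt q t - {0} \<and>
     ((even t \<or> odd t \<and> q mod 4 = 1) \<and> m \<notin> P_plus q t s \<union> P_minus q t s \<and>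
        (N_qt q t h = 1 \<or> N_qt q t h = - 1)
      \<or> odd t \<and> q mod 4 = 3 \<and> m \<in> P_plus q t s \<and> N_qt q t h = - 1
      \<or> odd t \<and> q mod 4 = 3 \<and> m \<notin> P_plus q t s \<union> P_minus q t s \<and>
        N_qt q t h = 1 \<and> h\<^sup>2 \<noteq> - 1)"

definition frob_pow :: "nat \<Rightarrow> nat \<Rightarrow> nat \<Rightarrow> 'a::{field,finite} \<Rightarrow> 'a" where
  "frob_pow q t i x = x ^ (q ^ (i mod (2 * t)))"

text \<open>
  The map is meant for \<open>h \<noteq> 0\<close>. The exponents of \<open>h\<close> are negative integers, hence the use
  of integer powers; reducing the exponents of \<open>q\<close> in them modulo \<open>2 * t\<close> would not change
  the coefficients, since \<open>h ^ (q ^ (2 * t)) = h\<close>.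
\<close>

definition psi :: "nat \<Rightarrow> nat \<Rightarrow> 'a::{field,finite} \<Rightarrow> 'a \<Rightarrow> nat \<Rightarrow> 'a \<Rightarrow> 'a" where
  "psi q t m h s x =
     m * (frob_pow q t s x
          - h powi (1 - int (q ^ (s * (t + 1)))) * frob_pow q t (s * (t + 1)) x)
     + frob_pow q t (s * (t - 1)) x
     + h powi (1 - int (q ^ (s * (2 * t - 1)))) * frob_pow q t (s * (2 * t - 1)) x"

definition U :: "('a \<Rightarrow> 'a) \<Rightarrow> ('a \<times> 'a) set" where
  "U f = {(x, f x) | x. True}"

definition field_automorphism :: "('a::field \<Rightarrow> 'a) \<Rightarrow> bool" where
  "field_automorphism \<sigma> \<longleftrightarrow>
     bij \<sigma> \<and> \<sigma> 1 = 1 \<and> (\<forall>x y. \<sigma> (x + y) = \<sigma> x + \<sigma> y) \<and> (\<forall>x y. \<sigma> (x * y) = \<sigma> x * \<sigma> y)"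

definition scale2 :: "'a::field \<Rightarrow> 'a \<times> 'a \<Rightarrow> 'a \<times> 'a" where
  "scale2 c v = (c * fst v, c * snd v)"

definition GammaL2 :: "('a::field \<times> 'a \<Rightarrow> 'a \<times> 'a) set" where
  "GammaL2 = {\<phi>. bij \<phi> \<and> (\<forall>u v. \<phi> (u + v) = \<phi> u + \<phi> v) \<and>
     (\<exists>\<sigma>. field_automorphism \<sigma> \<and> (\<forall>c v. \<phi> (scale2 c v) = scale2 (\<sigma> c) (\<phi> v)))}"

definition GammaL_equiv :: "('a::field \<Rightarrow> 'a) \<Rightarrow> ('a \<Rightarrow> 'a) \<Rightarrow> bool" where
  "GammaL_equiv f g \<longleftrightarrow> (\<exists>\<phi>\<in>GammaL2. \<phi> ` U f = U g)"

end

theory Submission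
  imports
    Defs
    "HOL-Algebra.Algebraic_Closure_Type"
    "HOL-Number_Theory.Residues"
begin

text \<open>
  Let \<open>K\<close> be the field with \<open>q ^ (2 * t)\<close> elements, \<open>E\<close> its subfield with \<open>q ^ t\<close> elements,
  \<open>\<tau>\<close> the involution of \<open>K\<close> over \<open>E\<close> and \<open>\<sigma>\<close> the automorphism \<open>x \<mapsto> x ^ (q ^ s)\<close>. The map
  \<open>psi q t m h s\<close> is the sum of a \<open>\<sigma>\<close>-semilinear and a \<open>\<sigma>\<^sup>-\<^sup>1\<close>-semilinear map of the plane \<open>K\<close>
  over \<open>E\<close>. If \<open>h\<close> has norm \<open>\<epsilon> = 1\<close> or \<open>\<epsilon> = - 1\<close>, both have rank at most one, because their kernels are
  given by equations \<open>\<tau> y = c * y\<close> with \<open>c * \<tau> c = 1\<close>. Unless the two kernels coincide, they split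
  \<open>K\<close>, and after rescaling the two coordinates of \<open>K \<times> K\<close> the graph becomes
  \<open>{(u + lam * \<sigma> v, v + rho * \<sigma> u) | u v. u \<in> E \<and> v \<in> E}\<close>, called a cross graph below. Both \<open>lam\<close>
  and \<open>rho\<close> lie on one line over \<open>E\<close>, which \<open>h\<close> determines through
  \<open>\<tau> lam * (\<sigma> h * \<sigma>\<^sup>-\<^sup>1 h) = - \<epsilon> * lam\<close>, and the norm of \<open>lam * rho\<close> down to the field with \<open>q\<close>
  elements is that of \<open>m\<close> (\<open>quadrinomial_normal_form\<close>).

  A matrix that takes one cross graph, with twist \<open>\<sigma>'\<close>, into another one, with twist \<open>\<sigma>\<close>, gives
  identities between combinations of the maps \<open>u\<close>, \<open>\<sigma> u\<close>, \<open>\<sigma>' u\<close> and \<open>\<sigma> (\<sigma>' u)\<close> on \<open>E\<close>. By the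
  independence of characters such identities hold only coefficientwise. They force \<open>\<sigma>'\<close> to agree on
  \<open>E\<close> with \<open>\<sigma>\<close> or with its inverse, and they leave two invariants up to inversion: the line
  through \<open>lam\<close>, and the norm of \<open>lam * rho\<close> (\<open>cross_graph_invariants\<close>). A field automorphism
  that accompanies the matrix only acts on these invariants.

  It remains to choose \<open>m\<close> and \<open>h\<close> so that the invariants differ. For \<open>psi q t 1 k l\<close> the norm in
  question is \<open>1\<close>; hence it suffices that the norm of \<open>m\<close> is not \<open>1\<close>. For \<open>psi q t \<mu> 1 l\<close> the line
  is the kernel of the trace to \<open>E\<close>; hence it suffices that \<open>h * \<sigma> (\<sigma> h) \<noteq> 1\<close>. An element \<open>h\<close> of
  order \<open>q ^ t + 1\<close> qualifies, since \<open>h * \<sigma> (\<sigma> h) = 1\<close> would place it in a field with at most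
  \<open>q ^ 4\<close> elements. For \<open>m\<close> one takes a generator of the multiplicative group of \<open>E\<close>, or its square
  if \<open>t\<close> is odd and \<open>q mod 4 = 1\<close>; the bounds on \<open>q\<close> ensure that its norm is not \<open>1\<close>. Nonzero elements
  of \<open>P_minus\<close> have norm \<open>1\<close>, and comparing orders shows that \<open>m\<close> is not in \<open>P_plus\<close>.
\<close>

hide_const (open) Divisibility.prime

section \<open>Automorphisms of a field and their independence\<close>

lemma automorphism_hom:
  assumes "field_automorphism f"
  shows "f 0 = 0" "f 1 = 1" "f (x + y) = f x + f y" "f (x * y) = f x * f y"
    "f (- x) = - f x" "f (x - y) = f x - f y" "f (x / y) = f x / f y" "f x = 0 \<longleftrightarrow> x = 0"
proof -
  note f = assms[unfolded field_automorphism_def]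
  show one: "f 1 = 1" and add: "\<And>x y. f (x + y) = f x + f y" and mult: "\<And>x y. f (x * y) = f x * f y"
    using f by auto
  show zero: "f 0 = 0"
    using add[of 0 0] by (metis add.right_neutral add_left_cancel)
  show minus: "\<And>x. f (- x) = - f x"
    using add zero by (metis add_eq_0_iff)
  show "f (x - y) = f x - f y"
    using add[of x "- y"] minus by simp
  show eq0: "\<And>x. f x = 0 \<longleftrightarrow> x = 0"
    using f zero by (metis bij_is_inj inj_eq)
  show "f (x / y) = f x / f y"
  proof (cases "y = 0")
    case False
    then have "f (x / y) * f y = f x" by (simp flip: mult)
    then show ?thesis using False eq0 by (simp add: field_simps)
  qed (simp add: zero)
qed

lemma comp_automorphism:
  assumes "field_automorphism f" "field_automorphism g"
  shows "field_automorphism (\<lambda>x. f (g x))"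
  using assms bij_comp[of g f] by (auto simp: field_automorphism_def o_def)

lemma id_automorphism: "field_automorphism (\<lambda>x. x)"
  by (auto simp: field_automorphism_def bij_def)

lemma automorphism_power: "field_automorphism \<theta> \<Longrightarrow> \<theta> (x ^ n) = \<theta> x ^ n"
  by (induction n) (simp_all add: automorphism_hom)

text \<open>
  Dedekind's argument: if \<open>w\<close> separates two of the characters, then subtracting a multiple of the
  given relation from its translate by \<open>w\<close> yields a relation with one term less.
\<close>

lemma independent_characters:
  fixes \<chi> :: "'i \<Rightarrow> 'a::field \<Rightarrow> 'a"
  assumes "finite I"
    and mult_closed: "\<And>u v. u \<in> S \<Longrightarrow> v \<in> S \<Longrightarrow> u * v \<in> S"
    and one: "1 \<in> S" "\<And>i. \<chi> i 1 = 1"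
    and mult: "\<And>i u v. \<chi> i (u * v) = \<chi> i u * \<chi> i v"
    and distinct: "\<And>i j. i \<in> I \<Longrightarrow> j \<in> I \<Longrightarrow> i \<noteq> j \<Longrightarrow> \<exists>u\<in>S. \<chi> i u \<noteq> \<chi> j u"
    and vanish: "\<And>u. u \<in> S \<Longrightarrow> (\<Sum>i\<in>I. c i * \<chi> i u) = 0"
    and "i \<in> I"
  shows "c i = 0"
  using assms(1) distinct vanish \<open>i \<in> I\<close>
proof (induction I arbitrary: c i rule: finite_induct)
  case (insert k I)
  have rest: "c j = 0" if "j \<in> I" for j
  proof -
    obtain w where w: "w \<in> S" "\<chi> j w \<noteq> \<chi> k w"
      using insert.prems(1)[of j k] \<open>j \<in> I\<close> insert.hyps(2) by auto
    have "(\<Sum>i\<in>I. (c i * (\<chi> i w - \<chi> k w)) * \<chi> i u) = 0" if u: "u \<in> S" for u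
    proof -
      have 1: "c k * \<chi> k (w * u) + (\<Sum>i\<in>I. c i * \<chi> i (w * u)) = 0"
        using insert.prems(2)[OF mult_closed[OF w(1) u]] insert.hyps by simp
      have 2: "c k * \<chi> k u + (\<Sum>i\<in>I. c i * \<chi> i u) = 0"
        using insert.prems(2)[OF u] insert.hyps by simp
      have "(\<Sum>i\<in>I. (c i * (\<chi> i w - \<chi> k w)) * \<chi> i u)
          = (\<Sum>i\<in>I. c i * \<chi> i (w * u)) - \<chi> k w * (\<Sum>i\<in>I. c i * \<chi> i u)"
        by (simp add: sum_distrib_left mult algebra_simps flip: sum_subtractf)
      also have "\<dots> = - (c k * \<chi> k (w * u)) + \<chi> k w * (c k * \<chi> k u)"
        using eq_neg_iff_add_eq_0[THEN iffD2, OF 1[unfolded add.commute[of "c k * _"]]]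
          eq_neg_iff_add_eq_0[THEN iffD2, OF 2[unfolded add.commute[of "c k * _"]]] by simp
      also have "\<dots> = 0"
        by (simp add: mult)
      finally show ?thesis .
    qed
    then have "c j * (\<chi> j w - \<chi> k w) = 0"
      using insert.IH[of "\<lambda>i. c i * (\<chi> i w - \<chi> k w)" j] insert.prems(1) \<open>j \<in> I\<close> by auto
    then show ?thesis using w(2) by simp
  qed
  have "c k = 0"
    using insert.prems(2)[OF one(1)] insert.hyps rest by (simp add: one)
  with rest insert.prems(3) show ?case by auto
qed simp

definition separates :: "'a set \<Rightarrow> ('a \<Rightarrow> 'a) \<Rightarrow> ('a \<Rightarrow> 'a) \<Rightarrow> bool" where
  "separates S f g \<longleftrightarrow> (\<exists>u\<in>S. f u \<noteq> g u)"

section \<open>A field with an involution\<close>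

text \<open>
  Abstracts the field with \<open>q ^ (2 * t)\<close> elements and its automorphism of order two, whose fixed
  field \<open>E\<close> is the subfield with \<open>q ^ t\<close> elements.
\<close>

locale involutive_field =
  fixes \<tau> :: "'a::field \<Rightarrow> 'a"
  assumes aut: "field_automorphism \<tau>"
    and involution: "\<tau> (\<tau> x) = x"
    and nontrivial: "\<exists>x. \<tau> x \<noteq> x"
begin

lemmas hom = automorphism_hom[OF aut]

definition "E = {u. \<tau> u = u}"

lemma E_closed [simp, intro]:
  "0 \<in> E" "1 \<in> E" "u \<in> E \<Longrightarrow> v \<in> E \<Longrightarrow> u + v \<in> E" "u \<in> E \<Longrightarrow> v \<in> E \<Longrightarrow> u * v \<in> E"
  "u \<in> E \<Longrightarrow> v \<in> E \<Longrightarrow> u - v \<in> E"  "u \<in> E \<Longrightarrow> v \<in> E \<Longrightarrow> u / v \<in> E"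
  by (auto simp: E_def hom)

text \<open>
  Together with uniqueness below: any \<open>w\<close> outside \<open>E\<close> completes \<open>1\<close> to a basis over \<open>E\<close>. The
  coordinates are found by applying \<open>\<tau>\<close> and solving two linear equations.
\<close>

lemma coordinates_exist:
  assumes "w \<notin> E"
  obtains z0 z1 where "z0 \<in> E" "z1 \<in> E" "z = z0 + w * z1"
proof -
  have ne: "w - \<tau> w \<noteq> 0"
    using assms by (auto simp: E_def)
  define z1 where "z1 = (z - \<tau> z) / (w - \<tau> w)"
  have "\<tau> z1 = (\<tau> z - z) / (\<tau> w - w)"
    by (simp add: z1_def hom involution)
  also have "\<dots> = z1"
    unfolding z1_def by (metis minus_diff_eq minus_divide_divide)
  finally have z1: "\<tau> z1 = z1" .
  then have E1: "z1 \<in> E" by (simp add: E_def)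
  have "(w - \<tau> w) * z1 = z - \<tau> z"
    using ne by (simp add: z1_def)
  then have "z - w * z1 \<in> E"
    by (simp add: E_def hom z1 algebra_simps)
  then show ?thesis using E1 by (intro that[of "z - w * z1" z1]) auto
qed

lemma coordinates_unique:
  assumes w: "w \<notin> E" and "x0 \<in> E" "x1 \<in> E" "y0 \<in> E" "y1 \<in> E"
    and eq: "x0 + w * x1 = y0 + w * y1"
  shows "x0 = y0" "x1 = y1"
proof -
  show "x1 = y1"
  proof (rule ccontr)
    assume "x1 \<noteq> y1"
    then have "w = (y0 - x0) / (x1 - y1)"
      using eq by (simp add: field_simps)
    then show False using assms by auto
  qed
  then show "x0 = y0" using eq by simp
qed

text \<open>
  The elements \<open>z + \<tau> c * \<tau> z\<close> satisfy the equation for every \<open>z\<close>, and they cannot all vanish, since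
  \<open>z = 1\<close> would give \<open>\<tau> c = - 1\<close> and then \<open>\<tau>\<close> would be the identity.
\<close>

lemma hilbert90:
  assumes "c * \<tau> c = 1"
  obtains a where "a \<noteq> 0" "\<tau> a = c * a"
proof -
  have c: "\<tau> (z + \<tau> c * \<tau> z) = c * (z + \<tau> c * \<tau> z)" for z
  proof -
    have "c * (z + \<tau> c * \<tau> z) = c * z + (c * \<tau> c) * \<tau> z" by (simp add: algebra_simps)
    then show ?thesis by (simp add: assms hom involution)
  qed
  have "\<exists>z. z + \<tau> c * \<tau> z \<noteq> 0"
  proof (rule ccontr)
    assume "\<not> ?thesis"
    then have all: "z + \<tau> c * \<tau> z = 0" for z by blast
    have "\<tau> c = - 1" using all[of 1] by (simp add: hom eq_neg_iff_add_eq_0 add.commute)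
    then have "\<tau> z = z" for z using all[of z] by simp
    then show False using nontrivial by blast
  qed
  then show ?thesis using c that by blast
qed

lemma independent_automorphisms:
  assumes "\<And>f. f \<in> set fs \<Longrightarrow> field_automorphism f"
    and "\<And>i j. i < j \<Longrightarrow> j < length fs \<Longrightarrow> separates E (fs ! i) (fs ! j)"
    and "length cs = length fs"
    and "\<And>u. u \<in> E \<Longrightarrow> (\<Sum>i<length fs. cs ! i * (fs ! i) u) = 0"
  shows "\<forall>c\<in>set cs. c = 0"
proof -
  define \<chi> where "\<chi> i = (if i < length fs then fs ! i else id)" for i
  have "field_automorphism (\<chi> i)" for i
    using assms(1) by (auto simp: \<chi>_def field_automorphism_def)
  note \<chi> = automorphism_hom[OF this]
  have "cs ! i = 0" if "i < length fs" for i
  proof (rule independent_characters[where I = "{..<length fs}" and S = E and \<chi> = \<chi> and c = "\<lambda>i. cs ! i"])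
    show "\<exists>u\<in>E. \<chi> i u \<noteq> \<chi> j u" if "i \<in> {..<length fs}" "j \<in> {..<length fs}" "i \<noteq> j" for i j
      using assms(2)[of i j] assms(2)[of j i] that
      by (cases i j rule: linorder_cases) (auto simp: separates_def \<chi>_def, metis)
    show "(\<Sum>i<length fs. cs ! i * \<chi> i u) = 0" if "u \<in> E" for u
      using assms(4)[OF that] by (simp add: \<chi>_def)
  qed (use \<chi> that in auto)
  then show ?thesis
    using assms(3) by (metis in_set_conv_nth)
qed

lemma independent_three_automorphisms:
  assumes "field_automorphism f0" "field_automorphism f1" "field_automorphism f2"
    and "separates E f0 f1" "separates E f0 f2" "separates E f1 f2"
    and "\<And>u. u \<in> E \<Longrightarrow> a * f0 u + b * f1 u + c * f2 u = 0"
  shows "a = 0" "b = 0" "c = 0"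
proof -
  have "\<forall>c\<in>set [a, b, c]. c = 0"
  proof (rule independent_automorphisms[where fs = "[f0, f1, f2]"])
    show "separates E ([f0, f1, f2] ! i) ([f0, f1, f2] ! j)" if "i < j" "j < length [f0, f1, f2]" for i j
      using that assms by (auto simp: less_Suc_eq numeral_2_eq_2 numeral_3_eq_3)
  qed (use assms in \<open>auto simp: numeral_3_eq_3 numeral_2_eq_2 lessThan_Suc algebra_simps\<close>)
  then show "a = 0" "b = 0" "c = 0" by auto
qed

lemma independent_four_automorphisms:
  assumes "field_automorphism f0" "field_automorphism f1" "field_automorphism f2" "field_automorphism f3"
    and "separates E f0 f1" "separates E f0 f2" "separates E f0 f3"
    and "separates E f1 f2" "separates E f1 f3" "separates E f2 f3"
    and "\<And>u. u \<in> E \<Longrightarrow> a * f0 u + b * f1 u + c * f2 u + d * f3 u = 0"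
  shows "a = 0" "b = 0" "c = 0" "d = 0"
proof -
  have "\<forall>c\<in>set [a, b, c, d]. c = 0"
  proof (rule independent_automorphisms[where fs = "[f0, f1, f2, f3]"])
    show "separates E ([f0, f1, f2, f3] ! i) ([f0, f1, f2, f3] ! j)" if "i < j" "j < length [f0, f1, f2, f3]" for i j
      using that assms by (auto simp: less_Suc_eq numeral_2_eq_2 numeral_3_eq_3)
  qed (use assms in \<open>auto simp: eval_nat_numeral lessThan_Suc algebra_simps\<close>)
  then show "a = 0" "b = 0" "c = 0" "d = 0" by auto
qed

section \<open>Cross graphs and the maps between them\<close>

text \<open>
  The normal form of the graphs: the sum of the two halves \<open>{(u, rho * \<sigma> u) | u. u \<in> E}\<close> and
  \<open>{(lam * \<sigma> v, v) | v. v \<in> E}\<close>, which are graphs of \<open>\<sigma>\<close>-semilinear maps over the two axes.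
\<close>

definition cross_graph :: "('a \<Rightarrow> 'a) \<Rightarrow> 'a \<Rightarrow> 'a \<Rightarrow> ('a \<times> 'a) set" where
  "cross_graph \<sigma> lam rho = {(u + lam * \<sigma> v, v + rho * \<sigma> u) | u v. u \<in> E \<and> v \<in> E}"

text \<open>
  The image under a matrix of one of the two halves of a cross graph, such as
  \<open>{(u, rho' * \<sigma>' u) | u. u \<in> E}\<close>, lies in another cross graph. Expanding in the bases \<open>1, lam\<close> and
  \<open>1, rho\<close> expresses \<open>x\<close>, \<open>\<sigma> y\<close>, \<open>y\<close> and \<open>\<sigma> x\<close> through \<open>u\<close> and \<open>\<sigma>' u\<close>; eliminating \<open>x\<close> and \<open>y\<close>
  leaves two identities on \<open>E\<close> in which only automorphisms occur.
\<close>

lemma half_image_equations: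
  assumes \<sigma>: "field_automorphism \<sigma>" and \<sigma>E: "\<And>u. u \<in> E \<Longrightarrow> \<sigma> u \<in> E"
    and \<sigma>': "field_automorphism \<sigma>'" and \<sigma>'E: "\<And>u. u \<in> E \<Longrightarrow> \<sigma>' u \<in> E"
    and nondeg: "lam \<notin> E" "rho \<notin> E"
    and half_image: "\<And>u. u \<in> E \<Longrightarrow> \<exists>x\<in>E. \<exists>y\<in>E. \<alpha> * u + \<beta> * \<sigma>' u = x + lam * \<sigma> y \<and> \<gamma> * u + \<delta> * \<sigma>' u = y + rho * \<sigma> x"
  obtains a0 a1 b0 b1 c0 c1 d0 d1 where
    "a0 \<in> E" "a1 \<in> E" "b0 \<in> E" "b1 \<in> E" "c0 \<in> E" "c1 \<in> E" "d0 \<in> E" "d1 \<in> E"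
    "\<alpha> = a0 + lam * a1" "\<beta> = b0 + lam * b1" "\<gamma> = c0 + rho * c1" "\<delta> = d0 + rho * d1"
    "\<And>u. u \<in> E \<Longrightarrow> \<sigma> c0 * \<sigma> u + \<sigma> d0 * \<sigma> (\<sigma>' u) = a1 * u + b1 * \<sigma>' u"
    "\<And>u. u \<in> E \<Longrightarrow> \<sigma> a0 * \<sigma> u + \<sigma> b0 * \<sigma> (\<sigma>' u) = c1 * u + d1 * \<sigma>' u"
proof -
  obtain a0 a1 where a: "a0 \<in> E" "a1 \<in> E" "\<alpha> = a0 + lam * a1" using coordinates_exist[OF nondeg(1)] .
  obtain b0 b1 where b: "b0 \<in> E" "b1 \<in> E" "\<beta> = b0 + lam * b1" using coordinates_exist[OF nondeg(1)] .
  obtain c0 c1 where c: "c0 \<in> E" "c1 \<in> E" "\<gamma> = c0 + rho * c1" using coordinates_exist[OF nondeg(2)] .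
  obtain d0 d1 where d: "d0 \<in> E" "d1 \<in> E" "\<delta> = d0 + rho * d1" using coordinates_exist[OF nondeg(2)] .
  have *: "\<sigma> c0 * \<sigma> u + \<sigma> d0 * \<sigma> (\<sigma>' u) = a1 * u + b1 * \<sigma>' u \<and> \<sigma> a0 * \<sigma> u + \<sigma> b0 * \<sigma> (\<sigma>' u) = c1 * u + d1 * \<sigma>' u"
    if u: "u \<in> E" for u
  proof -
    obtain x y where xy: "x \<in> E" "y \<in> E"
      and e1: "\<alpha> * u + \<beta> * \<sigma>' u = x + lam * \<sigma> y" and e2: "\<gamma> * u + \<delta> * \<sigma>' u = y + rho * \<sigma> x"
      using half_image[OF u] by blast
    have "x + lam * \<sigma> y = (a0 * u + b0 * \<sigma>' u) + lam * (a1 * u + b1 * \<sigma>' u)"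
      using e1 a b by (simp add: algebra_simps)
    from coordinates_unique[OF nondeg(1) _ _ _ _ this]
    have 1: "x = a0 * u + b0 * \<sigma>' u" "\<sigma> y = a1 * u + b1 * \<sigma>' u"
      using a b u xy \<sigma>E \<sigma>'E by auto
    have "y + rho * \<sigma> x = (c0 * u + d0 * \<sigma>' u) + rho * (c1 * u + d1 * \<sigma>' u)"
      using e2 c d by (simp add: algebra_simps)
    from coordinates_unique[OF nondeg(2) _ _ _ _ this]
    have 2: "y = c0 * u + d0 * \<sigma>' u" "\<sigma> x = c1 * u + d1 * \<sigma>' u"
      using c d u xy \<sigma>E \<sigma>'E by auto
    from 1(2) 2(2) show ?thesis
      unfolding 1(1) 2(1) by (simp add: automorphism_hom[OF \<sigma>])
  qed
  show ?thesis
    by (rule that[OF a(1,2) b(1,2) c(1,2) d(1,2) a(3) b(3) c(3) d(3)]) (use * in auto)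
qed

text \<open>
  The three lemmas from here on read off the coefficients of the two identities by independence. They
  differ in which of \<open>u\<close>, \<open>\<sigma> u\<close>, \<open>\<sigma>' u\<close> and \<open>\<sigma> (\<sigma>' u)\<close> coincide.
\<close>

lemma half_image_equal_twist:
  assumes \<sigma>: "field_automorphism \<sigma>" and \<sigma>E: "\<And>u. u \<in> E \<Longrightarrow> \<sigma> u \<in> E"
    and \<sigma>': "field_automorphism \<sigma>'" and \<sigma>'E: "\<And>u. u \<in> E \<Longrightarrow> \<sigma>' u \<in> E"
    and nondeg: "lam \<notin> E" "rho \<notin> E"
    and half_image: "\<And>u. u \<in> E \<Longrightarrow> \<exists>x\<in>E. \<exists>y\<in>E. \<alpha> * u + \<beta> * \<sigma>' u = x + lam * \<sigma> y \<and> \<gamma> * u + \<delta> * \<sigma>' u = y + rho * \<sigma> x"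
    and eq: "\<And>u. u \<in> E \<Longrightarrow> \<sigma>' u = \<sigma> u"
    and sep: "separates E (\<lambda>u. u) \<sigma>" "separates E (\<lambda>u. u) (\<lambda>u. \<sigma> (\<sigma> u))" "separates E \<sigma> (\<lambda>u. \<sigma> (\<sigma> u))"
  shows "\<alpha> \<in> E" "\<gamma> \<in> E" "\<beta> = lam * \<sigma> \<gamma>" "\<delta> = rho * \<sigma> \<alpha>"
proof -
  obtain a0 a1 b0 b1 c0 c1 d0 d1 where
    E: "a0 \<in> E" "a1 \<in> E" "b0 \<in> E" "b1 \<in> E" "c0 \<in> E" "c1 \<in> E" "d0 \<in> E" "d1 \<in> E"
    and decomp: "\<alpha> = a0 + lam * a1" "\<beta> = b0 + lam * b1" "\<gamma> = c0 + rho * c1" "\<delta> = d0 + rho * d1"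
    and 1: "\<And>u. u \<in> E \<Longrightarrow> \<sigma> c0 * \<sigma> u + \<sigma> d0 * \<sigma> (\<sigma>' u) = a1 * u + b1 * \<sigma>' u"
    and 2: "\<And>u. u \<in> E \<Longrightarrow> \<sigma> a0 * \<sigma> u + \<sigma> b0 * \<sigma> (\<sigma>' u) = c1 * u + d1 * \<sigma>' u"
    using half_image_equations[OF \<sigma> \<sigma>E \<sigma>' \<sigma>'E nondeg half_image] by blast
  note indep = independent_three_automorphisms[OF id_automorphism \<sigma> comp_automorphism[OF \<sigma> \<sigma>] sep]
  have "a1 * u + (b1 - \<sigma> c0) * \<sigma> u + (- \<sigma> d0) * \<sigma> (\<sigma> u) = 0" if "u \<in> E" for u
    using 1[OF that] by (simp add: eq that \<sigma>E algebra_simps)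
  note z1 = indep[OF this, simplified]
  have "c1 * u + (d1 - \<sigma> a0) * \<sigma> u + (- \<sigma> b0) * \<sigma> (\<sigma> u) = 0" if "u \<in> E" for u
    using 2[OF that] by (simp add: eq that \<sigma>E algebra_simps)
  note z2 = indep[OF this, simplified]
  show "\<alpha> \<in> E" "\<gamma> \<in> E" "\<beta> = lam * \<sigma> \<gamma>" "\<delta> = rho * \<sigma> \<alpha>"
    using z1 z2 E by (simp_all add: decomp automorphism_hom[OF \<sigma>])
qed

lemma half_image_inverse_twist:
  assumes \<sigma>: "field_automorphism \<sigma>" and \<sigma>E: "\<And>u. u \<in> E \<Longrightarrow> \<sigma> u \<in> E"
    and \<sigma>': "field_automorphism \<sigma>'" and \<sigma>'E: "\<And>u. u \<in> E \<Longrightarrow> \<sigma>' u \<in> E"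
    and nondeg: "lam \<notin> E" "rho \<notin> E"
    and half_image: "\<And>u. u \<in> E \<Longrightarrow> \<exists>x\<in>E. \<exists>y\<in>E. \<alpha> * u + \<beta> * \<sigma>' u = x + lam * \<sigma> y \<and> \<gamma> * u + \<delta> * \<sigma>' u = y + rho * \<sigma> x"
    and inv: "\<And>u. u \<in> E \<Longrightarrow> \<sigma> (\<sigma>' u) = u"
    and sep: "separates E (\<lambda>u. u) \<sigma>" "separates E (\<lambda>u. u) \<sigma>'" "separates E \<sigma> \<sigma>'"
  shows "\<beta> \<in> E" "\<delta> \<in> E" "\<alpha> = lam * \<sigma> \<delta>" "\<gamma> = rho * \<sigma> \<beta>"
proof -
  obtain a0 a1 b0 b1 c0 c1 d0 d1 where
    E: "a0 \<in> E" "a1 \<in> E" "b0 \<in> E" "b1 \<in> E" "c0 \<in> E" "c1 \<in> E" "d0 \<in> E" "d1 \<in> E"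
    and decomp: "\<alpha> = a0 + lam * a1" "\<beta> = b0 + lam * b1" "\<gamma> = c0 + rho * c1" "\<delta> = d0 + rho * d1"
    and 1: "\<And>u. u \<in> E \<Longrightarrow> \<sigma> c0 * \<sigma> u + \<sigma> d0 * \<sigma> (\<sigma>' u) = a1 * u + b1 * \<sigma>' u"
    and 2: "\<And>u. u \<in> E \<Longrightarrow> \<sigma> a0 * \<sigma> u + \<sigma> b0 * \<sigma> (\<sigma>' u) = c1 * u + d1 * \<sigma>' u"
    using half_image_equations[OF \<sigma> \<sigma>E \<sigma>' \<sigma>'E nondeg half_image] by blast
  note indep = independent_three_automorphisms[OF id_automorphism \<sigma> \<sigma>' sep]
  have "(a1 - \<sigma> d0) * u + (- \<sigma> c0) * \<sigma> u + b1 * \<sigma>' u = 0" if "u \<in> E" for u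
    using 1[OF that] by (simp add: inv that algebra_simps)
  note z1 = indep[OF this, simplified]
  have "(c1 - \<sigma> b0) * u + (- \<sigma> a0) * \<sigma> u + d1 * \<sigma>' u = 0" if "u \<in> E" for u
    using 2[OF that] by (simp add: inv that algebra_simps)
  note z2 = indep[OF this, simplified]
  show "\<beta> \<in> E" "\<delta> \<in> E" "\<alpha> = lam * \<sigma> \<delta>" "\<gamma> = rho * \<sigma> \<beta>"
    using z1 z2 E by (simp_all add: decomp automorphism_hom[OF \<sigma>])
qed

lemma half_image_unrelated_twist:
  assumes \<sigma>: "field_automorphism \<sigma>" and \<sigma>E: "\<And>u. u \<in> E \<Longrightarrow> \<sigma> u \<in> E"
    and \<sigma>': "field_automorphism \<sigma>'" and \<sigma>'E: "\<And>u. u \<in> E \<Longrightarrow> \<sigma>' u \<in> E"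
    and nondeg: "lam \<notin> E" "rho \<notin> E"
    and half_image: "\<And>u. u \<in> E \<Longrightarrow> \<exists>x\<in>E. \<exists>y\<in>E. \<alpha> * u + \<beta> * \<sigma>' u = x + lam * \<sigma> y \<and> \<gamma> * u + \<delta> * \<sigma>' u = y + rho * \<sigma> x"
    and sep: "separates E (\<lambda>u. u) \<sigma>" "separates E (\<lambda>u. u) \<sigma>'" "separates E (\<lambda>u. u) (\<lambda>u. \<sigma> (\<sigma>' u))"
      "separates E \<sigma> \<sigma>'" "separates E \<sigma> (\<lambda>u. \<sigma> (\<sigma>' u))" "separates E \<sigma>' (\<lambda>u. \<sigma> (\<sigma>' u))"
  shows "\<alpha> = 0" "\<gamma> = 0"
proof -
  obtain a0 a1 b0 b1 c0 c1 d0 d1 where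
    E: "a0 \<in> E" "a1 \<in> E" "b0 \<in> E" "b1 \<in> E" "c0 \<in> E" "c1 \<in> E" "d0 \<in> E" "d1 \<in> E"
    and decomp: "\<alpha> = a0 + lam * a1" "\<beta> = b0 + lam * b1" "\<gamma> = c0 + rho * c1" "\<delta> = d0 + rho * d1"
    and 1: "\<And>u. u \<in> E \<Longrightarrow> \<sigma> c0 * \<sigma> u + \<sigma> d0 * \<sigma> (\<sigma>' u) = a1 * u + b1 * \<sigma>' u"
    and 2: "\<And>u. u \<in> E \<Longrightarrow> \<sigma> a0 * \<sigma> u + \<sigma> b0 * \<sigma> (\<sigma>' u) = c1 * u + d1 * \<sigma>' u"
    using half_image_equations[OF \<sigma> \<sigma>E \<sigma>' \<sigma>'E nondeg half_image] by blast
  note indep = independent_four_automorphisms[OF id_automorphism \<sigma> \<sigma>' comp_automorphism[OF \<sigma> \<sigma>'] sep]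
  have "a1 * u + (- \<sigma> c0) * \<sigma> u + b1 * \<sigma>' u + (- \<sigma> d0) * \<sigma> (\<sigma>' u) = 0" if "u \<in> E" for u
    using 1[OF that] by (simp add: algebra_simps)
  note z1 = indep[OF this, simplified]
  have "c1 * u + (- \<sigma> a0) * \<sigma> u + d1 * \<sigma>' u + (- \<sigma> b0) * \<sigma> (\<sigma>' u) = 0" if "u \<in> E" for u
    using 2[OF that] by (simp add: algebra_simps)
  note z2 = indep[OF this, simplified]
  show "\<alpha> = 0" "\<gamma> = 0"
    using z1 z2 by (simp_all add: decomp automorphism_hom[OF \<sigma>])
qed

text \<open>
  Any two powers of the Frobenius map that occur as twists are in one of three relations. Each one
  records the coincidences among the identity, \<open>\<sigma>\<close>, \<open>\<sigma>'\<close> and the composition, together with the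
  distinctness that the independence argument needs.
\<close>

definition twists_unrelated where
  "twists_unrelated \<sigma> \<sigma>' \<longleftrightarrow>
    separates E (\<lambda>u. u) \<sigma> \<and> separates E (\<lambda>u. u) \<sigma>' \<and> separates E (\<lambda>u. u) (\<lambda>u. \<sigma> (\<sigma>' u)) \<and>
    separates E \<sigma> \<sigma>' \<and> separates E \<sigma> (\<lambda>u. \<sigma> (\<sigma>' u)) \<and> separates E \<sigma>' (\<lambda>u. \<sigma> (\<sigma>' u))"

definition twists_equal where
  "twists_equal \<sigma> \<sigma>' \<longleftrightarrow> (\<forall>u\<in>E. \<sigma>' u = \<sigma> u) \<and>
    separates E (\<lambda>u. u) \<sigma> \<and> separates E (\<lambda>u. u) (\<lambda>u. \<sigma> (\<sigma> u)) \<and> separates E \<sigma> (\<lambda>u. \<sigma> (\<sigma> u))"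

definition twists_inverse where
  "twists_inverse \<sigma> \<sigma>' \<longleftrightarrow> (\<forall>u\<in>E. \<sigma> (\<sigma>' u) = u) \<and>
    separates E (\<lambda>u. u) \<sigma> \<and> separates E (\<lambda>u. u) \<sigma>' \<and> separates E \<sigma> \<sigma>'"

text \<open>
  The matrix has the columns \<open>(p, x)\<close> and \<open>(r, y)\<close>. Applying the previous lemmas to both halves of
  the source gives, for equal twists,
  \<open>p * lam' = lam * \<sigma> y\<close>, \<open>x * lam' = rho * \<sigma> r\<close>, \<open>r * rho' = lam * \<sigma> x\<close>, \<open>y * rho' = rho * \<sigma> p\<close>,
  and similar equations for inverse twists. If \<open>p\<close> is not zero, neither is \<open>y\<close>, and the equations that
  involve these two yield both invariants; otherwise those that involve \<open>x\<close> and \<open>r\<close> do. For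
  \<open>p = 0\<close> the assumption that \<open>rho\<close> is on the line of \<open>lam\<close> brings the result into the same form.
  The parameter \<open>rho'\<close> may vanish, which covers \<open>psi q t 0 1 l\<close>.
\<close>

lemma cross_graph_invariants:
  assumes \<sigma>: "field_automorphism \<sigma>" and \<sigma>E: "\<And>u. u \<in> E \<Longrightarrow> \<sigma> u \<in> E"
    and \<sigma>': "field_automorphism \<sigma>'" and \<sigma>'E: "\<And>u. u \<in> E \<Longrightarrow> \<sigma>' u \<in> E"
    and nondeg: "lam \<notin> E" "rho \<notin> E" and ratio: "rho = c * lam" "c \<in> E"
    and Nm: "\<And>x y. Nm (x * y) = Nm x * Nm y" "\<And>x. Nm (\<sigma> x) = Nm x" "\<And>x. Nm x = 0 \<longleftrightarrow> x = 0"
    and twists: "twists_equal \<sigma> \<sigma>' \<or> twists_inverse \<sigma> \<sigma>' \<or> twists_unrelated \<sigma> \<sigma>'"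
    and col: "p \<noteq> 0 \<or> x \<noteq> 0"
    and maps: "(\<lambda>(z, w). (p * z + r * w, x * z + y * w)) ` cross_graph \<sigma>' lam' rho' \<subseteq> cross_graph \<sigma> lam rho"
  shows "(\<exists>e\<in>E. e \<noteq> 0 \<and> (lam' = e * lam \<or> lam' * lam = e)) \<and>
    (Nm (lam' * rho') = Nm (lam * rho) \<or> Nm (lam' * rho') * Nm (lam * rho) = (1 :: 'a))"
proof -
  have nz: "lam \<noteq> 0" "rho \<noteq> 0" "c \<noteq> 0"
    using nondeg ratio by auto
  note \<sigma>0 = automorphism_hom(8)[OF \<sigma>]
  have image: "\<exists>a\<in>E. \<exists>b\<in>E. p * (u + lam' * \<sigma>' v) + r * (v + rho' * \<sigma>' u) = a + lam * \<sigma> b \<and>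
      x * (u + lam' * \<sigma>' v) + y * (v + rho' * \<sigma>' u) = b + rho * \<sigma> a" if "u \<in> E" "v \<in> E" for u v
  proof -
    have "(u + lam' * \<sigma>' v, v + rho' * \<sigma>' u) \<in> cross_graph \<sigma>' lam' rho'"
      unfolding cross_graph_def using that by blast
    from subsetD[OF maps imageI[OF this]] show ?thesis
      unfolding cross_graph_def by auto
  qed
  \<comment> \<open>The halves \<open>v = 0\<close> and \<open>u = 0\<close>; they have the same shape after exchanging the columns.\<close>
  have half1: "\<exists>a\<in>E. \<exists>b\<in>E. p * u + (r * rho') * \<sigma>' u = a + lam * \<sigma> b \<and> x * u + (y * rho') * \<sigma>' u = b + rho * \<sigma> a"
    if "u \<in> E" for u
    using image[OF that E_closed(1)] by (simp add: automorphism_hom[OF \<sigma>'] mult.assoc)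
  have half2: "\<exists>a\<in>E. \<exists>b\<in>E. r * u + (p * lam') * \<sigma>' u = a + lam * \<sigma> b \<and> y * u + (x * lam') * \<sigma>' u = b + rho * \<sigma> a"
    if "u \<in> E" for u
    using image[OF E_closed(1) that] by (simp add: automorphism_hom[OF \<sigma>'] mult.assoc add.commute)
  consider (eq) "twists_equal \<sigma> \<sigma>'" | (inv) "twists_inverse \<sigma> \<sigma>'" | (other) "twists_unrelated \<sigma> \<sigma>'"
    using twists by blast
  then show ?thesis
  proof cases
    case eq
    then have eq': "\<And>u. u \<in> E \<Longrightarrow> \<sigma>' u = \<sigma> u" and sep: "separates E (\<lambda>u. u) \<sigma>"
       "separates E (\<lambda>u. u) (\<lambda>u. \<sigma> (\<sigma> u))" "separates E \<sigma> (\<lambda>u. \<sigma> (\<sigma> u))"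
      by (auto simp: twists_equal_def)
    have p: "p \<in> E" "x \<in> E" "r * rho' = lam * \<sigma> x" "y * rho' = rho * \<sigma> p"
      using half_image_equal_twist[OF \<sigma> \<sigma>E \<sigma>' \<sigma>'E nondeg half1 eq' sep] by blast+
    have r: "r \<in> E" "y \<in> E" "p * lam' = lam * \<sigma> y" "x * lam' = rho * \<sigma> r"
      using half_image_equal_twist[OF \<sigma> \<sigma>E \<sigma>' \<sigma>'E nondeg half2 eq' sep] by blast+
    show ?thesis
    proof (cases "p = 0")
      case False
      then have "y \<noteq> 0" using p(4) nz \<sigma>0[of p] by (metis mult_eq_0_iff)
      have l: "lam' = (\<sigma> y / p) * lam" and rh: "rho' = (\<sigma> p / y) * rho"
        using r(3) p(4) False \<open>y \<noteq> 0\<close> by (simp_all add: field_simps)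
      have "\<sigma> y / p \<in> E" "\<sigma> y / p \<noteq> 0"
        using p(1) r(2) \<sigma>E \<sigma>0 \<open>y \<noteq> 0\<close> False by auto
      moreover have "Nm (lam' * rho') = Nm (lam * rho)"
      proof -
        have "(y * p) * (lam' * rho') = \<sigma> (y * p) * (lam * rho)"
          using False \<open>y \<noteq> 0\<close> by (simp add: l rh automorphism_hom[OF \<sigma>])
        then have "Nm (y * p) * Nm (lam' * rho') = Nm (y * p) * Nm (lam * rho)"
          by (metis Nm(1,2))
        then show ?thesis
          using False \<open>y \<noteq> 0\<close> Nm(3) by simp
      qed
      ultimately show ?thesis using l by blast
    next
      case True
      then have "x \<noteq> 0" using col by auto
      then have "r \<noteq> 0" using p(3) nz \<sigma>0[of x] by (metis mult_eq_0_iff)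
      have l: "lam' = (\<sigma> r / x * c) * lam" and rh: "rho' = (\<sigma> x / r) * lam"
        using r(4) p(3) \<open>x \<noteq> 0\<close> \<open>r \<noteq> 0\<close> by (simp_all add: field_simps ratio)
      have "\<sigma> r / x * c \<in> E" "\<sigma> r / x * c \<noteq> 0"
        using p(2) r(1) \<sigma>E \<sigma>0 \<open>x \<noteq> 0\<close> \<open>r \<noteq> 0\<close> nz ratio by auto
      moreover have "Nm (lam' * rho') = Nm (lam * rho)"
      proof -
        have "(x * r) * (lam' * rho') = \<sigma> (x * r) * (lam * rho)"
          using \<open>x \<noteq> 0\<close> \<open>r \<noteq> 0\<close> by (simp add: l rh ratio automorphism_hom[OF \<sigma>])
        then have "Nm (x * r) * Nm (lam' * rho') = Nm (x * r) * Nm (lam * rho)"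
          by (metis Nm(1,2))
        then show ?thesis
          using \<open>x \<noteq> 0\<close> \<open>r \<noteq> 0\<close> Nm(3) by simp
      qed
      ultimately show ?thesis using l by blast
    qed
  next
    case inv
    then have inv': "\<And>u. u \<in> E \<Longrightarrow> \<sigma> (\<sigma>' u) = u" and sep: "separates E (\<lambda>u. u) \<sigma>"
       "separates E (\<lambda>u. u) \<sigma>'" "separates E \<sigma> \<sigma>'"
      by (auto simp: twists_inverse_def)
    have p: "r * rho' \<in> E" "y * rho' \<in> E" "p = lam * \<sigma> (y * rho')" "x = rho * \<sigma> (r * rho')"
      using half_image_inverse_twist[OF \<sigma> \<sigma>E \<sigma>' \<sigma>'E nondeg half1 inv' sep] by blast+
    have r: "p * lam' \<in> E" "x * lam' \<in> E" "r = lam * \<sigma> (x * lam')" "y = rho * \<sigma> (p * lam')"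
      using half_image_inverse_twist[OF \<sigma> \<sigma>E \<sigma>' \<sigma>'E nondeg half2 inv' sep] by blast+
    have norms: "Nm (lam' * rho') * Nm (lam * rho) = 1" if "z \<noteq> 0" "z = \<sigma> (z * (lam' * rho')) * (lam * rho)" for z
    proof -
      have "Nm z = Nm z * (Nm (lam' * rho') * Nm (lam * rho))"
        using that(2) by (metis Nm(1,2) mult.assoc)
      then show ?thesis using that(1) Nm(3) by simp
    qed
    show ?thesis
    proof (cases "p = 0")
      case False
      have ne: "\<sigma> (y * rho') \<noteq> 0" using p(3) False by auto
      then have "y \<noteq> 0" using \<sigma>0 by auto
      then have "lam' \<noteq> 0" using r(4) \<sigma>0 by auto
      have "\<sigma> (y * rho') \<in> E" using p(2) \<sigma>E by blast
      then have "p * lam' / \<sigma> (y * rho') \<in> E" using r(1) by blast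
      moreover have "lam' * lam = p * lam' / \<sigma> (y * rho')" using ne p(3) by (simp add: field_simps)
      moreover have "p * y = \<sigma> ((p * y) * (lam' * rho')) * (lam * rho)"
        by (subst p(3), subst r(4)) (simp add: automorphism_hom[OF \<sigma>] mult_ac)
      ultimately show ?thesis
        using norms[of "p * y"] False \<open>y \<noteq> 0\<close> \<open>lam' \<noteq> 0\<close> nz by (metis mult_eq_0_iff)
    next
      case True
      then have "x \<noteq> 0" using col by auto
      have ne: "\<sigma> (r * rho') \<noteq> 0" using p(4) \<open>x \<noteq> 0\<close> by auto
      then have "r \<noteq> 0" using \<sigma>0 by auto
      then have "lam' \<noteq> 0" using r(3) \<sigma>0 by auto
      have "\<sigma> (r * rho') \<in> E" using p(1) \<sigma>E by blast
      then have "x * lam' / (c * \<sigma> (r * rho')) \<in> E" using r(2) ratio by blast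
      moreover have "lam' * lam = x * lam' / (c * \<sigma> (r * rho'))" using ne p(4) nz by (simp add: field_simps ratio)
      moreover have "x * r = \<sigma> ((x * r) * (lam' * rho')) * (lam * rho)"
        by (subst p(4), subst r(3)) (simp add: automorphism_hom[OF \<sigma>] mult_ac)
      ultimately show ?thesis
        using norms[of "x * r"] \<open>x \<noteq> 0\<close> \<open>r \<noteq> 0\<close> \<open>lam' \<noteq> 0\<close> nz by (metis mult_eq_0_iff)
    qed
  next
    case other
    then show ?thesis
      using half_image_unrelated_twist[OF \<sigma> \<sigma>E \<sigma>' \<sigma>'E nondeg half1] col
      by (auto simp: twists_unrelated_def)
  qed
qed

section \<open>Quadrinomials as cross graphs\<close>

text \<open>
  The first summand of \<open>f\<close> kills \<open>b * E\<close> and the second one kills \<open>a * E\<close>, where \<open>a\<close> and \<open>b\<close> come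
  from Hilbert's Theorem 90. The genericity assumption on \<open>h\<close> says that \<open>b / a\<close> is not in \<open>E\<close>, so that
  \<open>a\<close> and \<open>b\<close> span the field. On these lines \<open>f\<close> takes the values \<open>m * A * \<sigma> u\<close> at \<open>a * u\<close> and \<open>B * v\<close>
  at \<open>b * \<sigma> v\<close>. Conjugates of \<open>A\<close> and \<open>B\<close> are computed from those of \<open>a\<close>, \<open>b\<close> and \<open>h\<close>; the factors
  \<open>1 + \<epsilon> * h * \<sigma> (\<sigma> h)\<close> and \<open>\<epsilon> + h * \<rho> (\<rho> h)\<close> in them are conjugate up to sign, so they cancel in
  the norm.
\<close>

lemma quadrinomial_normal_form:
  fixes Nm :: "'a \<Rightarrow> 'a"
  assumes \<sigma>: "field_automorphism \<sigma>" and \<rho>: "field_automorphism \<rho>"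
    and inv: "\<And>x. \<sigma> (\<rho> x) = x" "\<And>x. \<rho> (\<sigma> x) = x"
    and comm: "\<And>x. \<tau> (\<sigma> x) = \<sigma> (\<tau> x)" "\<And>x. \<tau> (\<rho> x) = \<rho> (\<tau> x)"
    and eps: "\<epsilon> = 1 \<or> \<epsilon> = - 1" and h: "h * \<tau> h = \<epsilon>" and generic: "h * \<sigma> (\<sigma> h) \<noteq> - \<epsilon>"
    and m: "m \<in> E"
    and Nm: "\<And>x y. Nm (x * y) = Nm x * Nm y" "\<And>x. Nm (\<sigma> x) = Nm x" "\<And>x. Nm (\<tau> x) = Nm x" "\<And>x. Nm x = 0 \<longleftrightarrow> x = 0"
    and f: "\<And>x. f x = m * (\<sigma> x - h / \<sigma> (\<tau> h) * \<sigma> (\<tau> x)) + \<tau> (\<rho> x) + h / \<rho> h * \<rho> x"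
  obtains a b lam c where "a \<noteq> 0" "b \<noteq> 0" "lam \<noteq> 0" "\<tau> lam * (\<sigma> h * \<rho> h) = - \<epsilon> * lam" "lam \<notin> E"
    "c \<in> E" "c = 0 \<longleftrightarrow> m = 0"
    "Nm (lam * (c * lam)) = Nm m"
    "U f = (\<lambda>(x, y). (a * x, b * y)) ` cross_graph \<sigma> lam (c * lam)"
proof -
  note hs = automorphism_hom[OF \<sigma>] and hr = automorphism_hom[OF \<rho>]
  have ee: "\<epsilon> * \<epsilon> = 1" and e0: "\<epsilon> \<noteq> 0" using eps by auto
  have fix_eps: "\<tau> \<epsilon> = \<epsilon>" "\<sigma> \<epsilon> = \<epsilon>" "\<rho> \<epsilon> = \<epsilon>" using eps by (auto simp: hom hs hr)
  have h0: "h \<noteq> 0" using h e0 by auto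
  have th: "\<tau> h = \<epsilon> / h" using h h0 by (simp add: field_simps)
  define k where "k = \<rho> (\<rho> h)"
  have k0: "k \<noteq> 0" "\<rho> h \<noteq> 0" "\<sigma> h \<noteq> 0" "\<sigma> (\<sigma> h) \<noteq> 0" using h0 by (auto simp: k_def hr hs)
  \<comment> \<open>This is the genericity assumption moved by the inverse of \<open>\<sigma>\<close>, applied twice.\<close>
  have generic': "\<epsilon> + h * k \<noteq> 0"
  proof
    assume "\<epsilon> + h * k = 0"
    then have "\<sigma> (\<sigma> (\<epsilon> + h * k)) = 0" by (simp add: hs)
    then have "\<epsilon> + \<sigma> (\<sigma> h) * h = 0" by (simp add: hs k_def inv fix_eps)
    then show False using generic by (simp add: eq_neg_iff_add_eq_0 add.commute mult.commute)
  qed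
  obtain a where a: "a \<noteq> 0" "\<tau> a = - (\<sigma> h / h) * a"
  proof (rule hilbert90)
    show "- (\<sigma> h / h) * \<tau> (- (\<sigma> h / h)) = 1"
      using h0 k0 e0 by (simp add: hom comm th hs fix_eps)
  qed
  obtain b where b: "b \<noteq> 0" "\<tau> b = \<epsilon> / (h * \<rho> h) * b"
  proof (rule hilbert90)
    show "\<epsilon> / (h * \<rho> h) * \<tau> (\<epsilon> / (h * \<rho> h)) = 1"
      using h0 k0 e0 ee by (simp add: hom comm th hr fix_eps)
  qed
  define lam where "lam = b / a"
  have lam0: "lam \<noteq> 0" using a b by (simp add: lam_def)
  have tlam: "\<tau> lam * (\<sigma> h * \<rho> h) = - \<epsilon> * lam"
    using a(1) h0 k0 by (simp add: lam_def hom a(2) b(2) field_simps)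
  have lamE: "lam \<notin> E"
  proof
    assume "lam \<in> E"
    then have "lam * (\<sigma> h * \<rho> h) = lam * - \<epsilon>" using tlam by (simp add: E_def)
    then have "\<sigma> h * \<rho> h = - \<epsilon>" using lam0 by (metis mult_cancel_left)
    then have "\<sigma> (\<sigma> h * \<rho> h) = \<sigma> (- \<epsilon>)" by simp
    then show False using generic by (simp add: hs inv fix_eps mult.commute)
  qed
  \<comment> \<open>\<open>A\<close> is the value of the inner bracket of \<open>f\<close> at \<open>a\<close>, and \<open>B\<close> that of the remaining part at \<open>b\<close>.\<close>
  define A where "A = \<sigma> a * (1 + \<epsilon> * h * \<sigma> (\<sigma> h))"
  define B where "B = \<rho> b * (\<epsilon> + h * k) / (\<rho> h * k)"
  have B0: "B \<noteq> 0" using generic' b k0 by (simp add: B_def hr)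
  have A0: "A \<noteq> 0"
  proof
    assume "A = 0"
    then have "1 + \<epsilon> * (h * \<sigma> (\<sigma> h)) = 0" using a by (simp add: A_def hs mult.assoc)
    then show False using generic eps by (auto simp: add_eq_0_iff)
  qed
  define c where "c = m * A / B / lam"
  have tA: "\<tau> A = - (\<epsilon> / (h * \<sigma> h)) * A"
    using eps h0 k0 by (elim disjE) (simp_all add: A_def hom comm a(2) hs th field_simps)
  have tk: "\<tau> k = \<epsilon> / k" by (simp add: k_def comm th hr fix_eps)
  have tB: "\<tau> B = \<rho> h / h * B"
  proof -
    have "\<tau> (\<rho> b) = \<epsilon> / (\<rho> h * k) * \<rho> b"
      by (simp add: comm b(2) hr fix_eps k_def)
    moreover have "\<tau> (\<epsilon> + h * k) = \<epsilon> * (\<epsilon> + h * k) / (h * k)"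
      using eps h0 k0 by (elim disjE) (simp_all add: hom th tk field_simps)
    moreover have "\<tau> (\<rho> h * k) = 1 / (\<rho> h * k)"
      using ee by (simp add: hom comm th tk hr fix_eps)
    ultimately have "\<tau> B = (\<epsilon> / (\<rho> h * k) * \<rho> b) * (\<epsilon> * (\<epsilon> + h * k) / (h * k)) / (1 / (\<rho> h * k))"
      unfolding B_def hom(4,7) by simp
    also have "\<dots> = (\<epsilon> * \<epsilon>) * (\<rho> b * (\<epsilon> + h * k) / (h * k))"
      using h0 k0 by (simp add: field_simps)
    also have "\<dots> = \<rho> h / h * B"
      using h0 k0 unfolding ee B_def by (simp add: field_simps)
    finally show ?thesis .
  qed
  have cE: "c \<in> E"
  proof -
    have tl: "\<tau> lam = - \<epsilon> / (\<sigma> h * \<rho> h) * lam"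
      using tlam k0 by (simp add: field_simps)
    have "\<tau> c = m * (- (\<epsilon> / (h * \<sigma> h)) * A) / (\<rho> h / h * B) / (- \<epsilon> / (\<sigma> h * \<rho> h) * lam)"
      using m by (simp add: c_def hom tA tB tl E_def)
    also have "\<dots> = c"
      using h0 k0 e0 by (simp add: c_def field_simps)
    finally show ?thesis by (simp add: E_def)
  qed
  have c0: "c = 0 \<longleftrightarrow> m = 0" using A0 B0 lam0 by (simp add: c_def)
  have on_a: "f (a * u) = m * A * \<sigma> u" if "u \<in> E" for u
  proof -
    have tu: "\<tau> u = u" using that by (simp add: E_def)
    have "\<sigma> (a * u) - h / \<sigma> (\<tau> h) * \<sigma> (\<tau> (a * u)) = A * \<sigma> u"
      using eps h0 k0 by (elim disjE) (simp_all add: hom hs tu th a(2) A_def field_simps)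
    moreover have "\<tau> (\<rho> (a * u)) + h / \<rho> h * \<rho> (a * u) = 0"
      using h0 k0 by (simp add: comm hom tu hr a(2) inv)
    ultimately show ?thesis by (simp add: f add.assoc)
  qed
  have on_b: "f (b * \<sigma> v) = B * v" if "v \<in> E" for v
  proof -
    have tv: "\<tau> v = v" using that by (simp add: E_def)
    have "\<sigma> (b * \<sigma> v) - h / \<sigma> (\<tau> h) * \<sigma> (\<tau> (b * \<sigma> v)) = 0"
      using eps h0 k0 by (elim disjE) (simp_all add: hom hs tv th b(2) comm inv)
    moreover have "\<tau> (\<rho> (b * \<sigma> v)) + h / \<rho> h * \<rho> (b * \<sigma> v) = B * v"
      using eps h0 k0 by (elim disjE) (simp_all add: comm hom tv hr b(2) inv B_def k_def field_simps)
    ultimately show ?thesis by (simp add: f add.assoc)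
  qed
  have add: "f (x + y) = f x + f y" for x y
    by (simp add: f hom hs hr algebra_simps)
  have pair: "(a * (u + lam * \<sigma> v), B * (v + (c * lam) * \<sigma> u)) = (a * u + b * \<sigma> v, f (a * u + b * \<sigma> v))"
    if "u \<in> E" "v \<in> E" for u v
    using on_a[OF that(1)] on_b[OF that(2)] a(1) B0 lam0
    by (simp add: add lam_def c_def field_simps)
  have "U f = (\<lambda>(x, y). (a * x, B * y)) ` cross_graph \<sigma> lam (c * lam)"
  proof (intro equalityI subsetI)
    fix P assume "P \<in> U f"
    then obtain x where P: "P = (x, f x)" by (auto simp: U_def)
    obtain u w where uw: "u \<in> E" "w \<in> E" "x / a = u + lam * w" using coordinates_exist[OF lamE] .
    have vE: "\<rho> w \<in> E" using uw by (simp add: E_def comm)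
    have "x = a * u + b * \<sigma> (\<rho> w)" using uw(3) a(1) by (simp add: inv lam_def field_simps)
    then have "P = (a * (u + lam * \<sigma> (\<rho> w)), B * (\<rho> w + (c * lam) * \<sigma> u))"
      using pair[OF uw(1) vE] P by simp
    then show "P \<in> (\<lambda>(x, y). (a * x, B * y)) ` cross_graph \<sigma> lam (c * lam)"
      using uw(1) vE by (intro image_eqI[of _ _ "(u + lam * \<sigma> (\<rho> w), \<rho> w + (c * lam) * \<sigma> u)"])
        (auto simp: cross_graph_def)
  next
    fix P assume "P \<in> (\<lambda>(x, y). (a * x, B * y)) ` cross_graph \<sigma> lam (c * lam)"
    then obtain u v where "u \<in> E" "v \<in> E" "P = (a * (u + lam * \<sigma> v), B * (v + (c * lam) * \<sigma> u))"
      by (auto simp: cross_graph_def)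
    then show "P \<in> U f" using pair[of u v] unfolding U_def by blast
  qed
  moreover have "Nm (lam * (c * lam)) = Nm m"
  proof -
    have N1: "Nm 1 = 1" using Nm(1)[of 1 1] Nm(4)[of 1] by simp
    have Nr: "Nm (\<rho> x) = Nm x" for x using Nm(2)[of "\<rho> x"] by (simp add: inv)
    have hh: "Nm h * Nm h = Nm \<epsilon>" using Nm(1)[of h "\<tau> h"] Nm(3) h by simp
    have Ne: "Nm \<epsilon> * Nm \<epsilon> = 1" using Nm(1)[of \<epsilon> \<epsilon>] ee N1 by simp
    define n where "n = Nm (\<epsilon> + h * k)"
    have n: "Nm (\<sigma> (\<sigma> (\<epsilon> + h * k))) = n" by (simp add: Nm(2) n_def)
    have "1 + \<epsilon> * h * \<sigma> (\<sigma> h) = \<epsilon> * \<sigma> (\<sigma> (\<epsilon> + h * k))"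
      using ee by (simp add: hs k_def inv fix_eps algebra_simps)
    then have NA: "Nm A = Nm a * Nm \<epsilon> * n" by (simp add: A_def Nm n flip: n_def)
    have "B * (\<rho> h * k) = \<rho> b * (\<epsilon> + h * k)" using k0 by (simp add: B_def)
    then have "Nm (B * (\<rho> h * k)) = Nm (\<rho> b * (\<epsilon> + h * k))" by simp
    then have NB: "Nm B * Nm \<epsilon> = Nm b * n" by (simp add: Nm Nr k_def hh flip: n_def) (simp add: n_def k_def)
    have "(lam * (c * lam)) * (a * B) = m * A * b"
      using a(1) b(1) B0 by (simp add: lam_def c_def)
    then have "Nm ((lam * (c * lam)) * (a * B)) = Nm (m * A * b)" by simp
    then have "Nm (lam * (c * lam)) * (Nm a * Nm B) = Nm m * Nm a * Nm \<epsilon> * n * Nm b"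
      by (simp add: Nm NA mult_ac)
    also have "\<dots> = Nm m * Nm a * Nm \<epsilon> * (Nm B * Nm \<epsilon>)" by (simp add: NB mult_ac)
    also have "\<dots> = Nm m * (Nm a * Nm B) * (Nm \<epsilon> * Nm \<epsilon>)" by (simp add: mult_ac)
    finally show ?thesis using Ne a(1) B0 Nm(4) by simp
  qed
  ultimately show ?thesis
    using that a(1) B0 lam0 tlam lamE cE c0 by blast
qed

section \<open>Semilinear equivalence\<close>

text \<open>
  Field automorphisms commute with \<open>\<tau>\<close> and the twist, so the one that belongs to the semilinear map
  turns a cross graph into the cross graph with conjugated parameters; the rescalings are absorbed into
  the matrix.
\<close>

lemma GammaL_equiv_cross_graph:
  assumes "GammaL_equiv f g"
    and f: "U f = (\<lambda>(x, y). (a' * x, b' * y)) ` cross_graph \<sigma>' lam' rho'" "a' \<noteq> 0" "b' \<noteq> 0"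
    and g: "U g = (\<lambda>(x, y). (a * x, b * y)) ` cross_graph \<sigma> lam rho" "a \<noteq> 0" "b \<noteq> 0"
    and comm: "\<And>\<theta> x. field_automorphism \<theta> \<Longrightarrow> \<theta> (\<tau> x) = \<tau> (\<theta> x)"
      "\<And>\<theta> x. field_automorphism \<theta> \<Longrightarrow> \<theta> (\<sigma>' x) = \<sigma>' (\<theta> x)"
  shows "\<exists>\<theta> p r x y. field_automorphism \<theta> \<and> (p \<noteq> 0 \<or> x \<noteq> 0) \<and>
    (\<lambda>(z, w). (p * z + r * w, x * z + y * w)) ` cross_graph \<sigma>' (\<theta> lam') (\<theta> rho') \<subseteq> cross_graph \<sigma> lam rho"
proof -
  obtain \<phi> where "\<phi> \<in> GammaL2" and graphs: "\<phi> ` U f = U g"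
    using assms(1) unfolding GammaL_equiv_def by (elim bexE)
  from this(1) have "bij \<phi> \<and> (\<forall>u v. \<phi> (u + v) = \<phi> u + \<phi> v) \<and>
      (\<exists>\<theta>. field_automorphism \<theta> \<and> (\<forall>c v. \<phi> (scale2 c v) = scale2 (\<theta> c) (\<phi> v)))"
    unfolding GammaL2_def by (rule CollectD)
  then obtain \<theta> where \<phi>: "bij \<phi>" "\<And>u v. \<phi> (u + v) = \<phi> u + \<phi> v"
    and \<theta>: "field_automorphism \<theta>" and semi: "\<And>c v. \<phi> (scale2 c v) = scale2 (\<theta> c) (\<phi> v)"
    by (elim conjE exE) simp
  note h\<theta> = automorphism_hom[OF \<theta>]
  obtain P X0 where c1: "\<phi> (1, 0) = (P, X0)" by fastforce
  obtain R Y0 where c2: "\<phi> (0, 1) = (R, Y0)" by fastforce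
  have mat: "\<phi> (x, y) = (P * \<theta> x + R * \<theta> y, X0 * \<theta> x + Y0 * \<theta> y)" for x y
  proof -
    have "\<phi> (x, y) = \<phi> (scale2 x (1, 0) + scale2 y (0, 1))" by (simp add: scale2_def)
    also have "\<dots> = scale2 (\<theta> x) (P, X0) + scale2 (\<theta> y) (R, Y0)" by (simp only: \<phi>(2) semi c1 c2)
    finally show ?thesis by (simp add: scale2_def mult.commute)
  qed
  have "\<phi> (0, 0) = (0, 0)" by (simp add: mat h\<theta>)
  then have ne: "P \<noteq> 0 \<or> X0 \<noteq> 0"
    using c1 inj_eq[OF bij_is_inj[OF \<phi>(1)], of "(1, 0)" "(0, 0)"] by auto
  \<comment> \<open>The matrix of \<open>\<phi>\<close>, corrected by the rescalings on both sides.\<close>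
  define p r x y where "p = \<theta> a' * P / a" "r = \<theta> b' * R / a" "x = \<theta> a' * X0 / b" "y = \<theta> b' * Y0 / b"
  note defs = this
  have E_preimage: "\<exists>u0\<in>E. u = \<theta> u0" if "u \<in> E" for u
  proof -
    have bt: "bij \<theta>" using \<theta> by (simp add: field_automorphism_def)
    obtain u0 where u0: "u = \<theta> u0" using bij_is_surj[OF bt] by (metis surj_def)
    have "\<theta> (\<tau> u0) = \<theta> u0" using that u0 comm(1)[OF \<theta>] by (simp add: E_def)
    then have "\<tau> u0 = u0" using bij_is_inj[OF bt] by (simp add: inj_eq)
    then show ?thesis using u0 by (auto simp: E_def)
  qed
  have "(p * z + r * w, x * z + y * w) \<in> cross_graph \<sigma> lam rho"
    if "(z, w) \<in> cross_graph \<sigma>' (\<theta> lam') (\<theta> rho')" for z w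
  proof -
    from that obtain u v where uv: "u \<in> E" "v \<in> E" "z = u + \<theta> lam' * \<sigma>' v" "w = v + \<theta> rho' * \<sigma>' u"
      by (auto simp: cross_graph_def)
    obtain u0 where u0: "u0 \<in> E" "u = \<theta> u0" using E_preimage[OF uv(1)] by (elim bexE)
    obtain v0 where v0: "v0 \<in> E" "v = \<theta> v0" using E_preimage[OF uv(2)] by (elim bexE)
    define Q where "Q = (u0 + lam' * \<sigma>' v0, v0 + rho' * \<sigma>' u0)"
    have z_eq: "z = \<theta> (fst Q)" and w_eq: "w = \<theta> (snd Q)"
      by (simp_all add: Q_def uv u0 v0 h\<theta> comm(2)[OF \<theta>])
    have "Q \<in> cross_graph \<sigma>' lam' rho'"
      unfolding cross_graph_def Q_def using u0(1) v0(1) by (intro CollectI exI[of _ u0] exI[of _ v0] conjI refl)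
    then have "(a' * fst Q, b' * snd Q) \<in> U f"
      unfolding f(1) by (intro image_eqI[of _ _ Q]) (simp_all add: case_prod_beta)
    then have "\<phi> (a' * fst Q, b' * snd Q) \<in> U g" unfolding graphs[symmetric] by (rule imageI)
    moreover have "\<phi> (a' * fst Q, b' * snd Q) = (a * (p * z + r * w), b * (x * z + y * w))"
      using g by (simp add: mat h\<theta> z_eq w_eq defs algebra_simps)
    ultimately show ?thesis
      unfolding g(1) using g(2,3) by (simp add: case_prod_beta image_iff prod_eq_iff) (metis prod.collapse)
  qed
  moreover have "p \<noteq> 0 \<or> x \<noteq> 0" using ne f g by (simp add: defs h\<theta>)
  ultimately show ?thesis
    using \<theta> by (intro exI[of _ \<theta>] exI[of _ p] exI[of _ r] exI[of _ x] exI[of _ y]) auto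
qed

end

text \<open>
  The invariants are compared for maps into a cross graph with \<open>rho \<notin> E\<close>. Symmetry allows
  \<open>psi q t \<mu> 1 l\<close> to be always the source, whatever \<open>\<mu>\<close> is.
\<close>

lemma GammaL_equiv_sym:
  assumes "GammaL_equiv f g"
  shows "GammaL_equiv g f"
proof -
  obtain \<phi> where "\<phi> \<in> GammaL2" and graphs: "\<phi> ` U f = U g"
    using assms unfolding GammaL_equiv_def by (elim bexE)
  from this(1) have "bij \<phi> \<and> (\<forall>u v. \<phi> (u + v) = \<phi> u + \<phi> v) \<and>
      (\<exists>\<theta>. field_automorphism \<theta> \<and> (\<forall>c v. \<phi> (scale2 c v) = scale2 (\<theta> c) (\<phi> v)))"
    unfolding GammaL2_def by (rule CollectD)
  then obtain \<theta> where \<phi>: "bij \<phi>" "\<And>u v. \<phi> (u + v) = \<phi> u + \<phi> v"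
    and \<theta>: "field_automorphism \<theta>" and semi: "\<And>c v. \<phi> (scale2 c v) = scale2 (\<theta> c) (\<phi> v)"
    by (elim conjE exE) simp
  note hom = automorphism_hom[OF \<theta>]
  have bt: "bij \<theta>" using \<theta> by (simp add: field_automorphism_def)
  note inv\<theta> = surj_f_inv_f[OF bij_is_surj[OF bt]] and inv\<phi> = surj_f_inv_f[OF bij_is_surj[OF \<phi>(1)]]
  have "field_automorphism (inv_into UNIV \<theta>)"
    unfolding field_automorphism_def
  proof (intro conjI allI)
    show "bij (inv_into UNIV \<theta>)" using bt by (rule bij_imp_bij_inv)
    show "inv_into UNIV \<theta> 1 = 1" by (rule inv_f_eq[OF bij_is_inj[OF bt]]) (simp add: hom)
    show "inv_into UNIV \<theta> (x + y) = inv_into UNIV \<theta> x + inv_into UNIV \<theta> y" for x y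
      by (rule inv_f_eq[OF bij_is_inj[OF bt]]) (simp add: hom inv\<theta>)
    show "inv_into UNIV \<theta> (x * y) = inv_into UNIV \<theta> x * inv_into UNIV \<theta> y" for x y
      by (rule inv_f_eq[OF bij_is_inj[OF bt]]) (simp add: hom inv\<theta>)
  qed
  moreover have "inv_into UNIV \<phi> (scale2 c v) = scale2 (inv_into UNIV \<theta> c) (inv_into UNIV \<phi> v)" for c v
    by (rule inv_f_eq[OF bij_is_inj[OF \<phi>(1)]]) (simp add: semi inv\<theta> inv\<phi>)
  moreover have "inv_into UNIV \<phi> (u + v) = inv_into UNIV \<phi> u + inv_into UNIV \<phi> v" for u v
    by (rule inv_f_eq[OF bij_is_inj[OF \<phi>(1)]]) (simp add: \<phi>(2) inv\<phi>)
  ultimately have "inv_into UNIV \<phi> \<in> GammaL2"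
    unfolding GammaL2_def using bij_imp_bij_inv[OF \<phi>(1)] by (intro CollectI conjI exI[of _ "inv_into UNIV \<theta>"]) simp_all
  moreover have "inv_into UNIV \<phi> ` U g = U f"
    unfolding graphs[symmetric] using \<phi>(1) by (simp add: bij_is_inj image_inv_f_f)
  ultimately show ?thesis unfolding GammaL_equiv_def by (intro bexI)
qed

section \<open>Finite fields\<close>

text \<open>
  The multiplicative group is cyclic. Here the order of the generator is expressed by divisibility,
  the only form in which it is used.
\<close>

lemma finite_field_generator:
  "\<exists>g :: 'a::{field,finite}. g \<noteq> 0 \<and> (\<forall>n. g ^ n = 1 \<longleftrightarrow> (CARD('a) - 1) dvd n) \<and>
    (\<forall>x. x \<noteq> 0 \<longrightarrow> (\<exists>i. x = g ^ i))"
proof -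
  interpret R: Ring.field "ring_of_type_algebra :: 'a ring"
    by (rule field_from_type_algebra)
  have pow: "x [^]\<^bsub>ring_of_type_algebra\<^esub> n = x ^ n" for x :: 'a and n :: nat
    by (induction n) (simp_all add: ring_of_type_algebra_def nat_pow_def)
  have carrier: "carrier (Multiplicative_Group.mult_of (ring_of_type_algebra :: 'a ring)) = UNIV - {0}"
    by (simp add: ring_of_type_algebra_def)
  have fin: "finite (carrier (ring_of_type_algebra :: 'a ring))"
    by (simp add: ring_of_type_algebra_def)
  from R.finite_field_mult_group_has_gen[OF fin] have "\<exists>g\<in>(UNIV :: 'a set) - {0}. UNIV - {0} = {g ^ i | i :: nat. i \<in> UNIV}"
    by (simp only: carrier pow)
  then obtain g :: 'a where nonzero: "g \<in> UNIV - {0}" and powers: "UNIV - {0} = {g ^ i | i :: nat. i \<in> UNIV}"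
    by (rule bexE)
  from nonzero have "g \<noteq> 0" by simp
  note g = this powers
  have cancel: "g ^ (j - i) = 1" if "i < j" "g ^ i = g ^ j" for i j :: nat
    using that g(1) by (simp add: power_diff)
  have "\<exists>i j :: nat. i < j \<and> g ^ i = g ^ j"
  proof (rule ccontr)
    assume "\<not> ?thesis"
    then have "inj (\<lambda>i :: nat. g ^ i)"
      by (intro injI) (metis linorder_neqE_nat)
    then show False
      using finite_imageD[of "\<lambda>i :: nat. g ^ i" UNIV] by simp
  qed
  then obtain i j :: nat where ij: "i < j" "g ^ i = g ^ j" by blast
  then have "0 < j - i \<and> g ^ (j - i) = 1" using cancel[of i j] by simp
  then have "\<exists>d > 0. g ^ d = 1" by blast
  define d where "d = (LEAST d. 0 < d \<and> g ^ d = 1)"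
  have d: "0 < d" "g ^ d = 1"
    using LeastI_ex[OF \<open>\<exists>d > 0. g ^ d = 1\<close>] by (simp_all add: d_def)
  have least: "d \<le> n" if "0 < n" "g ^ n = 1" for n
    unfolding d_def using that by (intro Least_le) simp
  have reduce: "g ^ n = g ^ (n mod d)" for n
  proof -
    have "g ^ n = g ^ (d * (n div d) + n mod d)" by simp
    also have "\<dots> = g ^ (n mod d)" by (simp only: power_add power_mult d(2)) simp
    finally show ?thesis .
  qed
  have order: "g ^ n = 1 \<longleftrightarrow> d dvd n" for n
    using reduce[of n] least[of "n mod d"] d(1) by (metis dvd_eq_mod_eq_0 mod_less_divisor neq0_conv not_less power_0)
  have "bij_betw (\<lambda>i. g ^ i) {..<d} (UNIV - {0})"
  proof (rule bij_betw_imageI)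
    show "inj_on (\<lambda>i. g ^ i) {..<d}"
    proof (rule linorder_inj_onI)
      fix i j assume ij: "i < j" "i \<in> {..<d}" "j \<in> {..<d}"
      show "g ^ i \<noteq> g ^ j"
      proof
        assume "g ^ i = g ^ j"
        then show False using cancel[of i j] ij least[of "j - i"] by auto
      qed
    qed auto
    show "(\<lambda>i. g ^ i) ` {..<d} = UNIV - {0}"
      unfolding g(2) using reduce d(1) by (auto simp: image_iff) (metis mod_less_divisor lessThan_iff)
  qed
  then have "CARD('a) - 1 = d"
    by (metis bij_betw_same_card card_lessThan card_Diff_singleton UNIV_I)
  moreover have "\<exists>i. x = g ^ i" if "x \<noteq> 0" for x
  proof -
    have "x \<in> {g ^ i | i :: nat. i \<in> UNIV}" unfolding powers[symmetric] using that by simp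
    then show ?thesis by blast
  qed
  ultimately show ?thesis using g(1) order by (intro exI[of _ g]) simp
qed

lemma power_power_fixed:
  fixes x :: "'a::monoid_mult" and Q :: nat
  assumes "x ^ (Q ^ a) = x"
  shows "x ^ (Q ^ (a * n)) = x"
  using assms by (induction n) (simp_all add: power_add power_mult)

text \<open>
  An element fixed by two powers of a Frobenius map is fixed by the power whose exponent is the
  greatest common divisor, by Bezout's identity.
\<close>

lemma power_power_fixed_gcd:
  fixes x :: "'a::monoid_mult" and Q :: nat
  assumes "x ^ (Q ^ a) = x" "x ^ (Q ^ b) = x" "a > 0"
  shows "x ^ (Q ^ gcd a b) = x"
proof -
  obtain i j where "a * i = b * j + gcd a b"
    using bezout_nat[of a b] assms(3) by auto
  then have "x ^ (Q ^ (a * i)) = (x ^ (Q ^ (b * j))) ^ (Q ^ gcd a b)"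
    by (simp add: power_add power_mult)
  then show ?thesis
    using power_power_fixed[OF assms(1)] power_power_fixed[OF assms(2)] by simp
qed

lemma odd_dvd_power_plus_one:
  fixes q n :: nat
  assumes "odd n"
  shows "(q + 1) dvd (q ^ n + 1)"
proof -
  obtain k where "n = 2 * k + 1" using assms oddE by blast
  moreover have "(q + 1) dvd (q ^ (2 * k + 1) + 1)"
  proof (induction k)
    case (Suc k)
    \<comment> \<open>Integers avoid the truncated subtraction in \<open>q - 1\<close>.\<close>
    have "int (q ^ (2 * Suc k + 1) + 1) = int q * int q * int (q ^ (2 * k + 1) + 1) - int (q + 1) * (int q - 1)"
      by (simp add: algebra_simps)
    moreover have "int (q + 1) dvd \<dots>"
      using Suc.IH by (intro dvd_diff dvd_mult dvd_triv_left) (simp only: of_nat_dvd_iff)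
    ultimately show ?case by (metis of_nat_dvd_iff)
  qed simp
  ultimately show ?thesis by simp
qed

lemma minus_one_dvd_power:
  fixes q n :: nat
  shows "(q - 1) dvd (q ^ n - 1)"
proof (cases "q = 0")
  case False
  then show ?thesis
    using power_diff_1_eq[of "int q" n] by (metis One_nat_def Suc_pred dvd_triv_left neq0_conv of_nat_1 of_nat_diff of_nat_dvd_iff of_nat_power one_le_power Suc_le_eq)
qed (cases n; simp)

locale quadratic_finite_field =
  fixes q t :: nat and type_of_field :: "'a::{field,finite} itself"
  assumes q: "primepow q" and odd_q: "odd q" and t: "t > 0" and card: "CARD('a) = q ^ (2 * t)"
begin

lemma q_gt_2: "q > 2"
  using primepow_gt_Suc_0[OF q] odd_q by (cases "q = 2") auto

lemma q_CHAR: "prime CHAR('a)" "\<exists>r. q = CHAR('a) ^ r"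
proof -
  show pr: "prime CHAR('a)"
    using prime_CHAR_semidom[where ?'a = 'a] finite_imp_CHAR_pos[where ?'a = 'a] by simp
  obtain p r where p: "prime p" "q = p ^ r" using q unfolding primepow_def by blast
  have "CHAR('a) dvd p ^ (r * (2 * t))"
    using CHAR_dvd_CARD[where ?'a = 'a] by (simp add: card p power_mult)
  then have "CHAR('a) dvd p" using pr prime_dvd_power by blast
  then have "CHAR('a) = p" using pr p(1) primes_dvd_imp_eq by blast
  then show "\<exists>r. q = CHAR('a) ^ r" using p by blast
qed

definition frob :: "nat \<Rightarrow> 'a \<Rightarrow> 'a" where
  "frob i x = x ^ (q ^ i)"

lemma frob_automorphism: "field_automorphism (frob i)"
proof -
  obtain r where r: "q = CHAR('a) ^ r" using q_CHAR(2) by blast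
  have add: "(x + y) ^ (q ^ i) = x ^ (q ^ i) + y ^ (q ^ i)" for x y :: 'a
    by (rule freshmans_dream'[OF q_CHAR(1), of _ "r * i"]) (simp add: r power_mult)
  have q0: "q ^ i > 0" using q_gt_2 by simp
  have "inj (\<lambda>x :: 'a. x ^ (q ^ i))"
  proof (rule injI)
    fix x y :: 'a assume "x ^ (q ^ i) = y ^ (q ^ i)"
    then have "(x - y) ^ (q ^ i) = 0"
      using add[of "x - y" y] by simp
    then show "x = y" by simp
  qed
  then have "bij (\<lambda>x :: 'a. x ^ (q ^ i))"
    by (simp add: finite_UNIV_inj_surj bij_def)
  then show ?thesis
    using add by (simp add: field_automorphism_def frob_def[abs_def] power_mult_distrib)
qed

lemma power_card: "x ^ (q ^ (2 * t)) = (x :: 'a)"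
proof (cases "x = 0")
  case False
  obtain g :: 'a where "g \<noteq> 0" and order: "\<And>n. g ^ n = 1 \<longleftrightarrow> (CARD('a) - 1) dvd n"
    and gen: "\<And>x. x \<noteq> 0 \<Longrightarrow> \<exists>i. x = g ^ i"
    using finite_field_generator[where ?'a = 'a] by blast
  obtain i where "x = g ^ i" using gen[OF False] by blast
  then have "x ^ (CARD('a) - 1) = (g ^ (CARD('a) - 1)) ^ i" by (simp add: mult.commute flip: power_mult)
  also have "\<dots> = 1" using order[of "CARD('a) - 1"] by simp
  finally have "x ^ Suc (CARD('a) - 1) = x" by (simp only: power_Suc mult_1_right)
  moreover have "Suc (CARD('a) - 1) = CARD('a)" by simp
  ultimately show ?thesis by (simp only: card)
qed (use q_gt_2 in \<open>simp add: power_0_left\<close>)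

lemmas frob_hom = automorphism_hom[OF frob_automorphism]

lemma frob_frob: "frob i (frob j x) = frob (i + j) x"
  by (simp add: frob_def power_add mult.commute flip: power_mult)

lemma frob_0: "frob 0 x = x"
  by (simp add: frob_def)

lemma frob_period: "frob (i + 2 * t * k) x = frob i x"
  using power_power_fixed[OF power_card] by (simp add: frob_def power_add power_mult)

lemma frob_mod: "frob (i mod (2 * t)) x = frob i x"
  using frob_period[of "i mod (2 * t)" "i div (2 * t)" x] by simp

lemma automorphism_frob: "field_automorphism \<theta> \<Longrightarrow> \<theta> (frob i x) = frob i (\<theta> x)"
  by (simp add: frob_def automorphism_power)

lemma qt_factor: "CARD('a) - 1 = (q ^ t - 1) * (q ^ t + 1)"
proof -
  have "CARD('a) = q ^ t * q ^ t" by (simp add: card mult_2 power_add)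
  then show ?thesis by (simp add: algebra_simps)
qed

lemma qt_gt_2: "q ^ t > 2"
  using q_gt_2 t by (metis less_le_trans self_le_power Suc_leI One_nat_def order_less_trans lessI numeral_2_eq_2 less_imp_le)

lemma field_generator:
  "\<exists>g :: 'a. g \<noteq> 0 \<and> (\<forall>n. g ^ n = 1 \<longleftrightarrow> ((q ^ t - 1) * (q ^ t + 1)) dvd n)"
  using finite_field_generator[where ?'a = 'a] unfolding qt_factor by metis

lemma subfield_generator:
  "\<exists>g :: 'a. g \<noteq> 0 \<and> frob t g = g \<and> (\<forall>n. g ^ n = 1 \<longleftrightarrow> (q ^ t - 1) dvd n)"
proof -
  obtain g :: 'a where g: "g \<noteq> 0" "\<And>n. g ^ n = 1 \<longleftrightarrow> ((q ^ t - 1) * (q ^ t + 1)) dvd n"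
    using field_generator by blast
  have ord: "(g ^ (q ^ t + 1)) ^ n = 1 \<longleftrightarrow> (q ^ t - 1) dvd n" for n
  proof -
    have nz: "q ^ t + 1 \<noteq> 0" by simp
    show ?thesis
      using g(2)[of "(q ^ t + 1) * n"] unfolding power_mult mult.commute[of "q ^ t - 1"]
      by (simp only: dvd_times_left_cancel_iff[OF nz])
  qed
  have "(g ^ (q ^ t + 1)) ^ Suc (q ^ t - 1) = g ^ (q ^ t + 1)"
    using ord[of "q ^ t - 1"] by (simp only: power_Suc) simp
  moreover have "Suc (q ^ t - 1) = q ^ t" using qt_gt_2 by simp
  ultimately have "frob t (g ^ (q ^ t + 1)) = g ^ (q ^ t + 1)" by (simp only: frob_def)
  then show ?thesis using ord g(1) by (intro exI[of _ "g ^ (q ^ t + 1)"]) simp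
qed

sublocale involutive_field "frob t"
proof
  show "field_automorphism (frob t)" by (rule frob_automorphism)
  show "frob t (frob t x) = x" for x
    unfolding frob_frob unfolding frob_def mult_2[symmetric] by (rule power_card)
  show "\<exists>x. frob t x \<noteq> x"
  proof (rule ccontr)
    assume fixed: "\<not> ?thesis"
    obtain g :: 'a where g: "g \<noteq> 0" "\<And>n. g ^ n = 1 \<longleftrightarrow> ((q ^ t - 1) * (q ^ t + 1)) dvd n"
      using field_generator by blast
    have "g ^ (q ^ t) = g" using fixed by (simp add: frob_def)
    moreover have "Suc (q ^ t - 1) = q ^ t" using qt_gt_2 by simp
    ultimately have "g * g ^ (q ^ t - 1) = g" by (metis power_Suc)
    then have "g ^ (q ^ t - 1) = 1" using g(1) by simp
    then have "(q ^ t - 1) * (q ^ t + 1) dvd q ^ t - 1" using g(2) by blast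
    then have "(q ^ t - 1) * (q ^ t + 1) \<le> (q ^ t - 1) * 1"
      using qt_gt_2 by (intro dvd_imp_le) auto
    then show False using qt_gt_2 q_gt_2 by (simp only: mult_le_cancel1) auto
  qed
qed

lemma frob_period_E: "u \<in> E \<Longrightarrow> frob (i + t * k) u = frob i u"
proof -
  assume "u \<in> E"
  then have "frob (t * k) u = u"
    using power_power_fixed[of u q t k] by (simp add: E_def frob_def)
  then show ?thesis by (simp flip: frob_frob)
qed

lemma frob_mod_E: "u \<in> E \<Longrightarrow> frob i u = frob (i mod t) u"
  using frob_period_E[of u "i mod t" "i div t"] by simp

lemma frob_E: "u \<in> E \<Longrightarrow> frob i u \<in> E"
proof -
  assume "u \<in> E"
  moreover have "frob t (frob i u) = frob i (frob t u)" by (simp add: frob_frob add.commute)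
  ultimately show ?thesis by (simp add: E_def)
qed

text \<open>
  If two powers of the Frobenius map agree on a generator of the multiplicative group of \<open>E\<close>, then
  this generator lies in the subfield with \<open>q ^ gcd t (j - i)\<close> elements, which must then be all of \<open>E\<close>.
\<close>

lemma frob_separates:
  assumes "i mod t \<noteq> j mod t"
  shows "separates E (frob i) (frob j)"
proof -
  have le: "\<not> separates E (frob i) (frob j) \<Longrightarrow> i \<le> j \<Longrightarrow> t dvd j - i" for i j
  proof -
    assume "\<not> separates E (frob i) (frob j)" and "i \<le> j"
    then have same: "\<And>u. u \<in> E \<Longrightarrow> frob i u = frob j u" by (auto simp: separates_def)
    obtain g :: 'a where g: "g \<noteq> 0" "frob t g = g" "\<And>n. g ^ n = 1 \<longleftrightarrow> (q ^ t - 1) dvd n"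
      using subfield_generator by blast
    define d where "d = gcd t (j - i)"
    have "frob i (frob (j - i) g) = frob i g"
      using same[of g] g(2) \<open>i \<le> j\<close> by (simp add: frob_frob E_def)
    then have "frob (j - i) g = g"
      using frob_automorphism[of i] by (simp add: field_automorphism_def bij_is_inj inj_eq)
    then have "g ^ (q ^ d) = g"
      unfolding d_def using power_power_fixed_gcd[of g q t "j - i"] g(2) t by (simp add: frob_def)
    moreover have "Suc (q ^ d - 1) = q ^ d" using q_gt_2 by simp
    ultimately have "g * g ^ (q ^ d - 1) = g" by (metis power_Suc)
    then have "(q ^ t - 1) dvd q ^ d - 1" using g(1,3) by simp
    moreover have "d > 0" using t by (simp add: d_def)
    then have "q ^ d - 1 > 0" using q_gt_2 one_less_power[of q d] by simp
    ultimately have "q ^ t - 1 \<le> q ^ d - 1" by (rule dvd_imp_le)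
    then have "q ^ t \<le> q ^ d" using \<open>q ^ d - 1 > 0\<close> by linarith
    then have "t \<le> d" using q_gt_2 by (simp add: power_increasing_iff)
    moreover have "d dvd t" by (simp add: d_def)
    ultimately have "d = t" using t by (meson dvd_imp_le le_antisym)
    then show "t dvd j - i" unfolding d_def by (metis gcd_dvd2)
  qed
  show ?thesis
  proof (rule ccontr)
    assume "\<not> ?thesis"
    moreover from this have "\<not> separates E (frob j) (frob i)"
      by (auto simp: separates_def)
    ultimately show False
      using le[of i j] le[of j i] assms by (metis nat_le_linear mod_eq_dvd_iff_nat)
  qed
qed

text \<open>
  Restricted to \<open>E\<close>, \<open>frob i\<close> depends only on \<open>i\<close> modulo \<open>t\<close>, so this is a matter of comparing the
  residues of \<open>0\<close>, \<open>s\<close>, \<open>l\<close> and \<open>s + l\<close>. Here \<open>2 * s\<close> is not divisible by \<open>t\<close>, because \<open>t\<close>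
  is coprime to \<open>s\<close> and larger than \<open>2\<close>.
\<close>

lemma twist_cases:
  assumes t5: "t \<ge> 5" and s: "gcd s (2 * t) = 1" and l: "gcd l (2 * t) = 1"
  shows "twists_equal (frob s) (frob l) \<or> twists_inverse (frob s) (frob l) \<or> twists_unrelated (frob s) (frob l)"
proof -
  have coprime: "coprime s t" "coprime l t"
    using s l by (simp_all only: coprime_iff_gcd_eq_1[symmetric] coprime_mult_right_iff)
  have s0: "s mod t \<noteq> 0" and l0: "l mod t \<noteq> 0"
    using coprime t5 by (auto simp: mod_eq_0_iff_dvd dest: coprime_common_divisor_nat[where x = t])
  have ss0: "(s + s) mod t \<noteq> 0"
  proof
    assume "(s + s) mod t = 0"
    then have "t dvd 2 * s" by (simp add: mod_eq_0_iff_dvd mult_2)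
    then have "t dvd 2" using coprime(1) by (metis coprime_commute coprime_dvd_mult_left_iff)
    then show False using t5 dvd_imp_le[of t 2] by simp
  qed
  have sep: "separates E (frob i) (frob j)" if "i mod t \<noteq> j mod t" for i j
    using frob_separates that .
  have frob0: "(\<lambda>u. u) = frob 0" by (simp add: fun_eq_iff frob_0)
  have comp: "(\<lambda>u. frob i (frob j u)) = frob (i + j)" for i j by (simp add: fun_eq_iff frob_frob)
  have shift: "(i + j) mod t \<noteq> i mod t" if "j mod t \<noteq> 0" for i j
    using that by (simp add: mod_eq_dvd_iff_nat mod_eq_0_iff_dvd)
  show ?thesis
  proof -
    consider "l mod t = s mod t" | "(s + l) mod t = 0" | "l mod t \<noteq> s mod t" "(s + l) mod t \<noteq> 0" by blast
    then show ?thesis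
    proof cases
      case 1
      have "frob l u = frob s u" if u: "u \<in> E" for u
        using frob_mod_E[OF u, of l] frob_mod_E[OF u, of s] 1 by simp
      then have "twists_equal (frob s) (frob l)"
        unfolding twists_equal_def frob0 comp
        using s0 ss0 shift[of s s] by (auto intro!: sep)
      then show ?thesis by blast
    next
      case 2
      have "frob s (frob l u) = u" if u: "u \<in> E" for u
        using frob_mod_E[OF u, of "s + l"] 2 by (simp add: frob_frob frob_0)
      moreover have "s mod t \<noteq> l mod t" using 2 ss0 by (metis mod_add_right_eq)
      ultimately have "twists_inverse (frob s) (frob l)"
        unfolding twists_inverse_def frob0
        using s0 l0 by (auto intro!: sep simp: frob_0)
      then show ?thesis by blast
    next
      case 3
      then have "twists_unrelated (frob s) (frob l)"
        unfolding twists_unrelated_def frob0 comp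
        using s0 l0 shift[of s l] shift[of l s] by (auto intro!: sep simp: add.commute)
      then show ?thesis by blast
    qed
  qed
qed

section \<open>The maps psi as cross graphs\<close>

text \<open>
  The norm to the field with \<open>q\<close> elements, as the power \<open>1 + q + \<dots> + q ^ (2 * t - 1)\<close>.
\<close>

definition norm_q :: "'a \<Rightarrow> 'a" where
  "norm_q x = x ^ ((q ^ (2 * t) - 1) div (q - 1))"

lemma norm_exponent: "(q - 1) * ((q ^ (2 * t) - 1) div (q - 1)) = q ^ (2 * t) - 1"
  using minus_one_dvd_power[of q "2 * t"] by simp

lemma norm_exponent_pos: "(q ^ (2 * t) - 1) div (q - 1) > 0"
proof (rule ccontr)
  assume "\<not> ?thesis"
  then have "q ^ (2 * t) - 1 = 0" using norm_exponent by simp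
  moreover have "q ^ (2 * t) > 1" using q_gt_2 t by (intro one_less_power) auto
  ultimately show False by simp
qed

lemma norm_q_mult: "norm_q (x * y) = norm_q x * norm_q y"
  by (simp add: norm_q_def power_mult_distrib)

lemma norm_q_eq_0: "norm_q x = 0 \<longleftrightarrow> x = 0"
  using norm_exponent_pos by (simp add: norm_q_def)

lemma norm_q_one: "norm_q 1 = 1"
  by (simp add: norm_q_def)

lemma norm_q_automorphism: "field_automorphism \<theta> \<Longrightarrow> \<theta> (norm_q x) = norm_q (\<theta> x)"
  by (simp add: norm_q_def automorphism_power)

lemma norm_q_frob: "norm_q (frob i x) = norm_q x"
proof (cases "x = 0")
  case False
  have "x ^ Suc (q ^ (2 * t) - 1) = x"
    using power_card[of x] q_gt_2 by simp
  then have x: "x ^ (q ^ (2 * t) - 1) = 1" using False by simp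
  have "norm_q x ^ (q - 1) = 1"
    unfolding norm_q_def power_mult[symmetric] mult.commute[of _ "q - 1"] norm_exponent by (rule x)
  then have "norm_q x ^ Suc (q - 1) = norm_q x" by simp
  moreover have "Suc (q - 1) = q" using q_gt_2 by simp
  ultimately have "norm_q x ^ (q ^ 1) = norm_q x" by simp
  from power_power_fixed[OF this, of i] have "frob i (norm_q x) = norm_q x"
    by (simp add: frob_def)
  then show ?thesis by (simp add: norm_q_automorphism[OF frob_automorphism])
qed (simp add: frob_hom)

lemma odd_of_coprime:
  assumes "gcd s (2 * t) = 1"
  shows "odd s"
proof
  assume "even s"
  then have "2 dvd gcd s (2 * t)" by simp
  then show False using assms by simp
qed

text \<open>
  Since \<open>s\<close> is odd, \<open>s * t\<close> is congruent to \<open>t\<close> modulo \<open>2 * t\<close>, so that the \<open>s * t\<close>-th power of the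
  Frobenius map is the involution.
\<close>

lemma psi_eq:
  assumes s: "gcd s (2 * t) = 1" and h: "h \<noteq> 0"
  shows "psi q t m h s x = m * (frob s x - h / frob s (frob t h) * frob s (frob t x))
    + frob t (frob (s * (2 * t - 1)) x) + h / frob (s * (2 * t - 1)) h * frob (s * (2 * t - 1)) x"
proof -
  obtain k where k: "s = 2 * k + 1" using odd_of_coprime[OF s] oddE by blast
  have fp: "frob_pow q t i y = frob i y" for i y
    unfolding frob_pow_def frob_mod[of i y, symmetric] by (simp add: frob_def)
  have pw: "h powi (1 - int (q ^ n)) = h / frob n h" for n
    by (subst power_int_diff) (simp_all add: h frob_def flip: of_nat_power)
  have st: "frob (s * (t + 1)) y = frob s (frob t y)" for y
  proof -
    have "s * (t + 1) = (s + t) + 2 * t * k" by (simp add: k algebra_simps)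
    then show ?thesis by (simp only: frob_period frob_frob)
  qed
  have st': "frob (s * (t - 1)) y = frob t (frob (s * (2 * t - 1)) y)" for y
  proof -
    obtain r where r: "t = Suc r" using t by (cases t) auto
    have "t + s * (2 * t - 1) = s * (t - 1) + 2 * t * (k + 1)" by (simp add: k r algebra_simps)
    then show ?thesis by (simp only: frob_period frob_frob)
  qed
  show ?thesis
    unfolding psi_def fp pw st st' by simp
qed

lemma N_qt_eq: "N_qt q t x = x * frob t x"
  by (simp add: N_qt_def frob_def)

lemma two_neq_zero: "(2 :: 'a) \<noteq> 0"
proof
  assume "(2 :: 'a) = 0"
  then have "of_nat 2 = (0 :: 'a)" by simp
  then have "CHAR('a) dvd 2" by (simp only: of_nat_eq_0_iff_char_dvd)
  then have "CHAR('a) = 2" using q_CHAR(1) by (metis primes_dvd_imp_eq two_is_prime_nat)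
  then show False using q_CHAR(2) odd_q q_gt_2 by (metis even_power even_numeral gr0I one_less_numeral_iff power_0 semiring_norm(76) not_less_iff_gr_or_eq)
qed

lemma minus_one_neq_one: "(- 1 :: 'a) \<noteq> 1"
  using two_neq_zero by (metis add.right_inverse one_add_one)

lemma subfield_eq_E: "subfield_qt q t = E"
  by (simp add: subfield_qt_def E_def frob_def)

lemma psi_normal_form:
  assumes s: "gcd s (2 * t) = 1" and eps: "\<epsilon> = 1 \<or> \<epsilon> = - 1" and h: "N_qt q t h = \<epsilon>"
    and generic: "h * frob s (frob s h) \<noteq> - \<epsilon>" and m: "m \<in> E"
  obtains a b lam c where "a \<noteq> 0" "b \<noteq> 0" "lam \<noteq> 0"
    "frob t lam * (frob s h * frob (s * (2 * t - 1)) h) = - \<epsilon> * lam" "lam \<notin> E"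
    "c \<in> E" "c = 0 \<longleftrightarrow> m = 0" "norm_q (lam * (c * lam)) = norm_q m"
    "U (psi q t m h s) = (\<lambda>(x, y). (a * x, b * y)) ` cross_graph (frob s) lam (c * lam)"
proof -
  have h0: "h \<noteq> 0" using h eps by (auto simp: N_qt_eq)
  have full: "s + s * (2 * t - 1) = 0 + 2 * t * s"
  proof -
    obtain r where "t = Suc r" using t by (cases t) auto
    then show ?thesis by (simp add: algebra_simps)
  qed
  have inverse: "frob s (frob (s * (2 * t - 1)) x) = x" "frob (s * (2 * t - 1)) (frob s x) = x" for x
    using frob_period[of 0 s x] by (simp_all only: frob_frob full add.commute[of _ s] frob_0)
  have comm: "frob t (frob i x) = frob i (frob t x)" for i x
    by (simp add: frob_frob add.commute)
  show ?thesis
    by (rule quadrinomial_normal_form[where \<sigma> = "frob s" and \<rho> = "frob (s * (2 * t - 1))" and \<epsilon> = \<epsilon>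
          and h = h and m = m and Nm = norm_q and f = "psi q t m h s"])
      (fact frob_automorphism inverse comm eps h[unfolded N_qt_eq] generic m norm_q_mult norm_q_frob
        norm_q_eq_0 psi_eq[OF s h0] that)+
qed

text \<open>
  Here \<open>\<theta>\<close> is the automorphism of the semilinear map. It conjugates the parameters of the source, and
  it commutes with the norm, which is a power map.
\<close>

lemma psi_equiv_invariants:
  assumes t5: "t \<ge> 5" and s: "gcd s (2 * t) = 1" and l: "gcd l (2 * t) = 1"
    and h: "N_qt q t h = 1" "h * frob s (frob s h) \<noteq> - 1" and m: "m \<in> E" "m \<noteq> 0"
    and eps: "\<epsilon> = 1 \<or> \<epsilon> = - 1" and k: "N_qt q t k = \<epsilon>" "k * frob l (frob l k) \<noteq> - \<epsilon>" and \<mu>: "\<mu> \<in> E"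
    and equiv: "GammaL_equiv (psi q t \<mu> k l) (psi q t m h s)"
  obtains \<theta> lam lam' e where "field_automorphism \<theta>" "lam' \<noteq> 0"
    "frob t lam * (frob s h * frob (s * (2 * t - 1)) h) = - lam"
    "frob t lam' * (frob l k * frob (l * (2 * t - 1)) k) = - \<epsilon> * lam'"
    "e \<in> E" "e \<noteq> 0" "\<theta> lam' = e * lam \<or> \<theta> lam' * lam = e"
    "norm_q (\<theta> \<mu>) = norm_q m \<or> norm_q (\<theta> \<mu>) * norm_q m = 1"
proof -
  obtain a b lam c where nf: "a \<noteq> 0" "b \<noteq> 0" "lam \<noteq> 0"
    "frob t lam * (frob s h * frob (s * (2 * t - 1)) h) = - 1 * lam" "lam \<notin> E"
    "c \<in> E" "c = 0 \<longleftrightarrow> m = 0" "norm_q (lam * (c * lam)) = norm_q m"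
    "U (psi q t m h s) = (\<lambda>(x, y). (a * x, b * y)) ` cross_graph (frob s) lam (c * lam)"
    by (rule psi_normal_form[OF s _ h(1) h(2) m(1)]) auto
  obtain a' b' lam' c' where nf': "a' \<noteq> 0" "b' \<noteq> 0" "lam' \<noteq> 0"
    "frob t lam' * (frob l k * frob (l * (2 * t - 1)) k) = - \<epsilon> * lam'" "lam' \<notin> E"
    "c' \<in> E" "c' = 0 \<longleftrightarrow> \<mu> = 0" "norm_q (lam' * (c' * lam')) = norm_q \<mu>"
    "U (psi q t \<mu> k l) = (\<lambda>(x, y). (a' * x, b' * y)) ` cross_graph (frob l) lam' (c' * lam')"
    by (rule psi_normal_form[OF l eps k(1) k(2) \<mu>])
  have "\<exists>\<theta> p r x y. field_automorphism \<theta> \<and> (p \<noteq> 0 \<or> x \<noteq> 0) \<and>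
      (\<lambda>(z, w). (p * z + r * w, x * z + y * w)) ` cross_graph (frob l) (\<theta> lam') (\<theta> (c' * lam'))
      \<subseteq> cross_graph (frob s) lam (c * lam)"
    by (rule GammaL_equiv_cross_graph[OF equiv nf'(9) nf'(1,2) nf(9) nf(1,2)]) (fact automorphism_frob)+
  then obtain \<theta> p r x y where \<theta>: "field_automorphism \<theta>" and col: "p \<noteq> 0 \<or> x \<noteq> 0"
    and maps: "(\<lambda>(z, w). (p * z + r * w, x * z + y * w)) ` cross_graph (frob l) (\<theta> lam') (\<theta> (c' * lam'))
      \<subseteq> cross_graph (frob s) lam (c * lam)"
    by (elim exE conjE)
  have cE: "c * lam \<notin> E"
  proof
    assume "c * lam \<in> E"
    then have "c * lam / c \<in> E" using nf(6) by blast
    then show False using nf(5,7) m(2) by simp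
  qed
  have inv: "(\<exists>e\<in>E. e \<noteq> 0 \<and> (\<theta> lam' = e * lam \<or> \<theta> lam' * lam = e)) \<and>
      (norm_q (\<theta> lam' * \<theta> (c' * lam')) = norm_q (lam * (c * lam)) \<or>
      norm_q (\<theta> lam' * \<theta> (c' * lam')) * norm_q (lam * (c * lam)) = 1)"
    by (rule cross_graph_invariants[where \<sigma> = "frob s" and \<sigma>' = "frob l" and lam = lam and rho = "c * lam"
          and lam' = "\<theta> lam'" and rho' = "\<theta> (c' * lam')" and c = c and p = p and r = r and x = x and y = y
          and Nm = norm_q])
      (fact frob_automorphism frob_E nf(5) cE refl nf(6) norm_q_mult norm_q_frob norm_q_eq_0
        twist_cases[OF t5 s l] col maps)+
  then obtain e where e: "e \<in> E" "e \<noteq> 0" "\<theta> lam' = e * lam \<or> \<theta> lam' * lam = e" by (elim conjE bexE)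
  have "norm_q (\<theta> lam' * \<theta> (c' * lam')) = \<theta> (norm_q \<mu>)"
    unfolding nf'(8)[symmetric] norm_q_automorphism[OF \<theta>] by (simp add: automorphism_hom[OF \<theta>])
  also have "\<dots> = norm_q (\<theta> \<mu>)" by (rule norm_q_automorphism[OF \<theta>])
  finally have norm: "norm_q (\<theta> lam' * \<theta> (c' * lam')) = norm_q (\<theta> \<mu>)" .
  have "norm_q (\<theta> lam' * \<theta> (c' * lam')) = norm_q (lam * (c * lam)) \<or>
      norm_q (\<theta> lam' * \<theta> (c' * lam')) * norm_q (lam * (c * lam)) = 1"
    using inv by (rule conjunct2)
  then have "norm_q (\<theta> \<mu>) = norm_q m \<or> norm_q (\<theta> \<mu>) * norm_q m = 1"
    unfolding norm nf(8) .
  moreover have "frob t lam * (frob s h * frob (s * (2 * t - 1)) h) = - lam" using nf(4) by simp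
  ultimately show ?thesis using that[OF \<theta> nf'(3) _ nf'(4) e] by blast
qed

text \<open>
  This makes the normal form available for every \<open>psi q t 1 k l\<close>. If the product were \<open>1\<close>, the
  automorphism \<open>frob (2 * l)\<close> would invert \<open>k\<close>. Iterating it \<open>t\<close> times gives the identity; for odd \<open>t\<close>
  this means \<open>k * k = 1\<close> and \<open>k\<close> has norm \<open>1\<close>. For even \<open>t\<close> already \<open>t div 2\<close> iterations give the
  involution, so that \<open>k\<close> has norm \<open>1\<close> or \<open>k * k\<close>; in the second case \<open>k\<close> is a primitive fourth root
  of unity, fixed by \<open>frob (2 * l)\<close> because \<open>4\<close> divides \<open>q\<^sup>2 - 1\<close>.
\<close>

lemma minus_one_norm_generic:
  assumes l: "gcd l (2 * t) = 1" and k: "N_qt q t k = - 1"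
  shows "k * frob l (frob l k) \<noteq> 1"
proof
  assume k1: "k * frob l (frob l k) = 1"
  have k0: "k \<noteq> 0" using k1 by auto
  have "odd l" using odd_of_coprime[OF l] .
  then obtain j where j: "l = 2 * j + 1" using oddE by blast
  have step: "frob (2 * l) k = 1 / k" using k1 k0 unfolding frob_frob mult_2 by (simp add: nonzero_eq_divide_eq mult.commute)
  have iter: "frob (2 * l * i) k = (if even i then k else 1 / k)" for i
  proof (induction i)
    case (Suc i)
    have "frob (2 * l * Suc i) k = frob (2 * l) (frob (2 * l * i) k)" by (simp add: frob_frob)
    then show ?case using Suc step by (simp add: frob_hom)
  qed (simp add: frob_0)
  have square: "k * k = 1 \<Longrightarrow> False"
  proof -
    assume "k * k = 1"
    then have "k = 1 \<or> k = - 1" by (simp add: square_eq_1_iff)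
    then have "k * frob t k = 1" by (auto simp: frob_hom)
    then show False using k minus_one_neq_one by (simp add: N_qt_eq)
  qed
  show False
  proof (cases "even t")
    case False
    have "frob (2 * l * t) k = k" using frob_period[of 0 l k] by (simp add: frob_0 mult_ac)
    then have "k * k = 1" using iter[of t] False k0 by (simp add: field_simps)
    then show False by (rule square)
  next
    case True
    then obtain r where r: "t = 2 * r" by blast
    have "2 * l * r = t + 2 * t * j" by (simp add: r j algebra_simps)
    then have "frob t k = (if even r then k else 1 / k)" using iter[of r] frob_period[of t j k] by simp
    then have "even r" and kk: "k * k = - 1"
      using k k0 minus_one_neq_one by (auto simp: N_qt_eq split: if_splits)
    have "k * (k * k) * (k * k) = k" using kk by simp
    then have k4: "k ^ 4 = 1" using k0 by (simp add: power4_eq_xxxx mult_ac)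
    have "4 dvd q ^ (2 * l) - 1"
    proof -
      have "(q\<^sup>2 - 1) dvd (q\<^sup>2) ^ l - 1" by (rule minus_one_dvd_power)
      moreover have "4 dvd q\<^sup>2 - 1"
      proof -
        obtain i where "q = 2 * i + 1" using odd_q oddE by blast
        then show ?thesis by (simp add: power2_eq_square algebra_simps)
      qed
      ultimately show ?thesis by (metis dvd_trans power_mult)
    qed
    then obtain i where i: "q ^ (2 * l) - 1 = 4 * i" by blast
    have "q ^ (2 * l) = Suc (4 * i)" using i q_gt_2 by (metis Suc_diff_1 less_imp_le less_trans pos2 zero_less_power)
    then have "frob (2 * l) k = k" unfolding frob_def by (simp add: power_mult k4)
    then have "k * k = 1" using step k0 by (simp add: field_simps)
    then show False by (rule square)
  qed
qed

section \<open>Choice of the parameters\<close>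

text \<open>
  Any element \<open>h\<close> of order \<open>q ^ t + 1\<close> will do: if \<open>h * frob (2 * s) h\<close> were \<open>1\<close> or \<open>- 1\<close>, then \<open>h\<close>
  would be fixed by \<open>frob (4 * s)\<close>, hence by \<open>frob 4\<close>, and \<open>q ^ t + 1\<close> would divide \<open>q ^ 4 - 1\<close>.
\<close>

lemma exists_norm_one_generic:
  assumes t5: "t \<ge> 5" and s: "gcd s (2 * t) = 1"
  shows "\<exists>h. N_qt q t h = 1 \<and> h\<^sup>2 \<noteq> - 1 \<and> h * frob s (frob s h) \<noteq> 1 \<and> h * frob s (frob s h) \<noteq> - 1"
proof -
  obtain g :: 'a where g: "g \<noteq> 0" "\<And>n. g ^ n = 1 \<longleftrightarrow> ((q ^ t - 1) * (q ^ t + 1)) dvd n"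
    using field_generator by blast
  define h where "h = g ^ (q ^ t - 1)"
  have h0: "h \<noteq> 0" using g by (simp add: h_def)
  have nz: "q ^ t - 1 \<noteq> 0" using qt_gt_2 by simp
  have ord: "h ^ n = 1 \<longleftrightarrow> (q ^ t + 1) dvd n" for n
    unfolding h_def power_mult[symmetric] g(2) by (rule dvd_times_left_cancel_iff[OF nz])
  have big: "q ^ 4 < q ^ t" using t5 q_gt_2 by (intro power_strict_increasing) auto
  have not4: "h ^ (q ^ 4) \<noteq> h"
  proof
    assume "h ^ (q ^ 4) = h"
    moreover have Suc4: "Suc (q ^ 4 - 1) = q ^ 4" using q_gt_2 by simp
    ultimately have "h * h ^ (q ^ 4 - 1) = h" by (metis power_Suc)
    then have "(q ^ t + 1) dvd q ^ 4 - 1" using ord h0 by simp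
    moreover have "q ^ 4 > 1" using q_gt_2 by (intro one_less_power) auto
    ultimately have "q ^ t + 1 \<le> q ^ 4 - 1" by (intro dvd_imp_le) auto
    then show False using big by linarith
  qed
  \<comment> \<open>Squaring treats the values \<open>1\<close> and \<open>- 1\<close> at once.\<close>
  have generic: "(h * frob s (frob s h))\<^sup>2 \<noteq> 1"
  proof
    assume "(h * frob s (frob s h))\<^sup>2 = 1"
    then have pm: "h * frob (2 * s) h = 1 \<or> h * frob (2 * s) h = - 1"
      unfolding frob_frob mult_2 by (simp add: power2_eq_1_iff)
    have "frob (2 * s) (h * frob (2 * s) h) = h * frob (2 * s) h"
      using pm by (elim disjE) (simp_all only: frob_hom(2,5))
    then have "frob (2 * s) h * frob (4 * s) h = frob (2 * s) h * h"
      by (simp add: frob_hom(4) frob_frob mult.commute)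
    then have "frob (4 * s) h = h" using h0 by (simp add: frob_hom)
    then have "h ^ (q ^ gcd (2 * t) (4 * s)) = h"
      using power_power_fixed_gcd[of h q "2 * t" "4 * s"] power_card t by (simp add: frob_def)
    moreover have "gcd (2 * t) (4 * s) dvd 4"
    proof -
      have "gcd (2 * t) (4 * s) dvd gcd (4 * (2 * t)) (4 * s)"
        by (intro gcd_greatest dvd_mult[OF gcd_dvd1] gcd_dvd2)
      also have "gcd (4 * (2 * t)) (4 * s) = 4 * gcd s (2 * t)"
        by (metis gcd.commute gcd_mult_distrib_nat)
      finally show ?thesis using s by simp
    qed
    ultimately have "h ^ (q ^ 4) = h"
      using power_power_fixed by (metis dvdE)
    then show False using not4 by simp
  qed
  have "h\<^sup>2 \<noteq> - 1"
  proof
    assume "h\<^sup>2 = - 1"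
    then have "h ^ (2 * 2) = 1" unfolding power_mult by simp
    then have "(q ^ t + 1) dvd 4" using ord[of 4] by simp
    then have "q ^ t + 1 \<le> 4" by (intro dvd_imp_le) auto
    moreover have "2 ^ 4 \<le> q ^ 4" using q_gt_2 by (intro power_mono) auto
    ultimately show False using big by simp
  qed
  moreover have "N_qt q t h = 1" unfolding N_qt_def ord by (rule dvd_refl)
  moreover have "h * frob s (frob s h) \<noteq> 1" "h * frob s (frob s h) \<noteq> - 1"
    using generic by (metis one_power2, metis one_power2 power2_minus)
  ultimately show ?thesis by (intro exI[of _ h] conjI)
qed

lemma ker_Tr_power:
  assumes "w \<in> ker_Tr q t" "w \<noteq> 0"
  shows "w ^ (q ^ t - 1) = - 1"
proof -
  have "w ^ (q ^ t) = - w" using assms(1) by (simp add: ker_Tr_def Tr_qt_def add_eq_0_iff)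
  moreover have "Suc (q ^ t - 1) = q ^ t" using qt_gt_2 by simp
  ultimately have "w * w ^ (q ^ t - 1) = w * - 1" by (metis power_Suc mult_minus1_right)
  then show ?thesis using assms(2) by (metis mult_cancel_left)
qed

text \<open>
  Elements \<open>w ^ (q ^ s - 1)\<close> are quotients of conjugates.
\<close>

lemma norm_q_P_minus:
  assumes "m \<in> P_minus q t s" "m \<noteq> 0"
  shows "norm_q m = 1"
proof -
  obtain w where w: "m = w ^ (q ^ s - 1)" using assms by (auto simp: P_minus_def)
  show ?thesis
  proof (cases "w = 0")
    case True
    then have "m = 1" using w assms(2) by (cases "q ^ s - 1") auto
    then show ?thesis by (simp add: norm_q_one)
  next
    case False
    have "Suc (q ^ s - 1) = q ^ s" using q_gt_2 by simp
    then have "w * m = frob s w" unfolding w frob_def by (metis power_Suc)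
    then have "norm_q w * norm_q m = norm_q w" by (metis norm_q_mult norm_q_frob)
    then show ?thesis using False by (simp add: norm_q_eq_0)
  qed
qed

text \<open>
  The norm from the large field of an element of \<open>E\<close> is the square of its norm from \<open>E\<close>, which
  accounts for the factor \<open>2\<close>: modulo \<open>q - 1\<close>, the factor \<open>q ^ t + 1\<close> of the exponent is \<open>2\<close>.
\<close>

lemma norm_q_generator_power:
  assumes g: "g \<noteq> 0" "\<And>n. g ^ n = 1 \<longleftrightarrow> (q ^ t - 1) dvd n" and "norm_q (g ^ j) = 1"
  shows "(q - 1) dvd 2 * j"
proof -
  define N where "N = (q ^ (2 * t) - 1) div (q - 1)"
  have "g ^ (j * N) = 1" using assms(3) by (simp add: norm_q_def N_def power_mult)
  then have "(q ^ t - 1) dvd j * N" using g(2) by blast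
  then have "(q - 1) * (q ^ t - 1) dvd (q - 1) * (j * N)" by (rule mult_dvd_mono[OF dvd_refl])
  also have "(q - 1) * (j * N) = j * ((q ^ t - 1) * (q ^ t + 1))"
    using norm_exponent qt_factor card unfolding N_def by (metis mult.left_commute)
  finally have "(q ^ t - 1) * (q - 1) dvd (q ^ t - 1) * (j * (q ^ t + 1))"
    by (simp only: mult.commute mult.left_commute)
  moreover have nz: "q ^ t - 1 \<noteq> 0" using qt_gt_2 by simp
  ultimately have "(q - 1) dvd j * (q ^ t + 1)" by (simp only: dvd_times_left_cancel_iff[OF nz])
  also have "j * (q ^ t + 1) = j * (q ^ t - 1) + 2 * j"
  proof -
    have "q ^ t + 1 = (q ^ t - 1) + 2" using qt_gt_2 by simp
    then show ?thesis by (metis distrib_left mult.commute)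
  qed
  finally show ?thesis
    using dvd_mult[OF minus_one_dvd_power[of q t], of j] by (simp only: dvd_add_right_iff)
qed

text \<open>
  An element of \<open>P_plus\<close> satisfies an equation that a suitable power \<open>j\<close> of a generator violates. For
  even \<open>t\<close> the number \<open>q + 1\<close> divides both \<open>q ^ s + 1\<close> and \<open>q ^ t - 1\<close>, which makes the order of such
  an element divide \<open>2 * (q ^ t - 1) div (q + 1)\<close>. For odd \<open>t\<close> the nonzero elements of \<open>P_plus\<close> are
  either all squares or all nonsquares in \<open>E\<close>, according to the parity of \<open>(q ^ s + 1) div 2\<close>, and \<open>j\<close>
  is chosen to have the other quadratic character.
\<close>

lemma exists_admissible_multiplier:
  assumes s: "gcd s (2 * t) = 1" and q: "odd t \<and> q \<ge> 7 \<or> even t \<and> q \<ge> 5"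
  shows "\<exists>m. m \<in> E \<and> m \<noteq> 0 \<and> norm_q m \<noteq> 1 \<and> m \<notin> P_plus q t s"
proof -
  obtain g :: 'a where g: "g \<noteq> 0" "frob t g = g" "\<And>n. g ^ n = 1 \<longleftrightarrow> (q ^ t - 1) dvd n"
    using subfield_generator by blast
  \<comment> \<open>The parity of \<open>j\<close> decides whether \<open>m\<close> is a square in \<open>E\<close>.\<close>
  define j :: nat where "j = (if odd t \<and> q mod 4 = 1 then 2 else 1)"
  define m where "m = g ^ j"
  have m0: "m \<noteq> 0" using g(1) by (simp add: m_def)
  have mE: "m \<in> E" using automorphism_power[OF frob_automorphism, of t g j] g(2) by (simp add: E_def m_def)
  have m_power: "m ^ n = 1 \<longleftrightarrow> (q ^ t - 1) dvd j * n" for n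
    using g(3)[of "j * n"] by (simp add: m_def power_mult)
  have odd_s: "odd s" using odd_of_coprime[OF s] .
  have norm: "norm_q m \<noteq> 1"
  proof
    assume "norm_q m = 1"
    then have "(q - 1) dvd 2 * j" using norm_q_generator_power[OF g(1,3)] unfolding m_def by blast
    then have "q - 1 \<le> 2 * j" by (rule dvd_imp_le) (simp add: j_def)
    then show False using q by (auto simp: j_def split: if_splits)
  qed
  have "m \<notin> P_plus q t s"
  proof
    assume "m \<in> P_plus q t s"
    then obtain w where w: "w \<in> ker_Tr q t" "m = w ^ (q ^ s + 1)" by (auto simp: P_plus_def)
    then have "w \<noteq> 0" using m0 by auto
    then have w1: "w ^ (q ^ t - 1) = - 1" using ker_Tr_power w(1) by blast
    show False
    proof (cases "even t")
      case True
      then obtain r where r: "t = 2 * r" by blast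
      have "q\<^sup>2 - 1 = (q + 1) * (q - 1)" by (simp add: power2_eq_square algebra_simps)
      then have "(q + 1) dvd q\<^sup>2 - 1" by (metis dvd_triv_left)
      also have "\<dots> dvd q ^ t - 1" using minus_one_dvd_power[of "q\<^sup>2" r] by (simp add: r power_mult)
      finally obtain R where R: "q ^ t - 1 = (q + 1) * R" by blast
      obtain c where c: "q ^ s + 1 = (q + 1) * c" using odd_dvd_power_plus_one[OF odd_s] by blast
      have "m ^ (2 * R) = w ^ (((q + 1) * c) * (2 * R))" by (simp only: w(2) c power_mult)
      also have "((q + 1) * c) * (2 * R) = (q ^ t - 1) * (2 * c)" by (simp only: R mult_ac)
      also have "w ^ ((q ^ t - 1) * (2 * c)) = 1" by (simp only: power_mult w1) simp
      finally have "(q ^ t - 1) dvd j * (2 * R)" using m_power by blast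
      then have "(q ^ t - 1) dvd 2 * R" using True by (simp add: j_def)
      moreover have "R > 0" using R qt_gt_2 by (cases R) auto
      ultimately have "(q + 1) * R \<le> 2 * R" using R dvd_imp_le[of "q ^ t - 1" "2 * R"] by simp
      then show False using \<open>R > 0\<close> q_gt_2 by simp
    next
      case False
      have "odd (q ^ t)" unfolding even_power using odd_q by blast
      then obtain R where "q ^ t = 2 * R + 1" by (rule oddE)
      then have R: "q ^ t - 1 = 2 * R" by simp
      have "odd (q ^ s)" unfolding even_power using odd_q by blast
      then have "even (q ^ s + 1)" by (simp only: even_plus_one_iff not_False_eq_True)
      then obtain c where c: "q ^ s + 1 = 2 * c" by (rule evenE)
      have R0: "R > 0" using R qt_gt_2 by (cases R) auto
      have "m ^ R = w ^ ((2 * c) * R)" by (simp only: w(2) c power_mult)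
      also have "(2 * c) * R = (q ^ t - 1) * c" by (simp only: R mult_ac)
      also have "w ^ ((q ^ t - 1) * c) = (- 1) ^ c" by (simp only: power_mult w1)
      finally have mR: "m ^ R = (- 1) ^ c" .
      show False
      proof (cases "q mod 4 = 1")
        case True
        have "m ^ R = 1" using m_power[of R] True False R by (simp add: j_def)
        moreover have "odd c"
        proof
          assume "even c"
          then have "(q ^ s + 1) mod 4 = 0" using c by auto
          moreover have "q ^ s mod 4 = 1" using power_mod[of q 4 s] True by simp
          ultimately show False by presburger
        qed
        ultimately show False using mR minus_one_neq_one by simp
      next
        case q3: False
        have "q mod 4 = 3" using q3 odd_q by presburger
        then have "4 dvd q + 1" by presburger
        then have "4 dvd 2 * c" using odd_dvd_power_plus_one[OF odd_s, of q] c by (metis dvd_trans)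
        then have "even c" by presburger
        then have "(q ^ t - 1) dvd R" using mR m_power[of R] q3 by (simp add: j_def)
        then show False using R R0 dvd_imp_le[of "q ^ t - 1" R] by simp
      qed
    qed
  qed
  then show ?thesis using m0 mE norm by blast
qed

end

section \<open>Existence of new maps\<close>

theorem corollary4p4:
  fixes q t s :: nat
  assumes "primepow q" and "odd q"
    and "t \<ge> 5"
    and "s > 0" and "gcd s (2 * t) = 1"
    and "CARD('a::{field,finite}) = q ^ (2 * t)"
    and "odd t \<and> q \<ge> 7 \<or> even t \<and> q \<ge> 5"
  shows "\<exists>(m::'a) (h::'a). admissible q t s m h \<and>
    (\<forall>l::nat. l > 0 \<and> gcd l (2 * t) = 1 \<longrightarrow>
      (\<forall>k::'a. N_qt q t k = - 1 \<longrightarrow>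
        (\<forall>\<mu>\<in>subfield_qt q t.
          \<not> GammaL_equiv (psi q t 1 k l) (psi q t m h s) \<and>
          \<not> GammaL_equiv (psi q t m h s) (psi q t \<mu> 1 l))))"
proof -
  interpret quadratic_finite_field q t "TYPE('a)"
    using assms by unfold_locales auto
  note s = assms(5)
  obtain h :: 'a where h: "N_qt q t h = 1" "h\<^sup>2 \<noteq> - 1"
    "h * frob s (frob s h) \<noteq> 1" "h * frob s (frob s h) \<noteq> - 1"
    using exists_norm_one_generic[OF assms(3) s] by blast
  obtain m :: 'a where m: "m \<in> E" "m \<noteq> 0" "norm_q m \<noteq> 1" "m \<notin> P_plus q t s"
    using exists_admissible_multiplier[OF s assms(7)] by blast
  have "m \<notin> P_minus q t s" using norm_q_P_minus m(2,3) by blast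
  moreover have "q mod 4 = 1 \<or> q mod 4 = 3" using assms(2) by presburger
  ultimately have "admissible q t s m h"
    using m h(1,2) unfolding admissible_def subfield_eq_E by blast
  moreover have "\<not> GammaL_equiv (psi q t 1 k l) (psi q t m h s)"
    if l: "gcd l (2 * t) = 1" and k: "N_qt q t k = - 1" for l and k :: 'a
  proof
    assume equiv: "GammaL_equiv (psi q t 1 k l) (psi q t m h s)"
    have generic: "k * frob l (frob l k) \<noteq> - (- 1)"
      using minus_one_norm_generic[OF l k] by simp
    obtain \<theta> where "field_automorphism \<theta>" "norm_q (\<theta> 1) = norm_q m \<or> norm_q (\<theta> 1) * norm_q m = 1"
      using psi_equiv_invariants[OF assms(3) s l h(1,4) m(1,2) disjI2[OF refl] k generic E_closed(2) equiv] by metis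
    then show False using m(3) by (simp add: automorphism_hom norm_q_one)
  qed
  moreover have "\<not> GammaL_equiv (psi q t m h s) (psi q t \<mu> 1 l)"
    if l: "gcd l (2 * t) = 1" and \<mu>: "\<mu> \<in> subfield_qt q t" for l and \<mu> :: 'a
  proof
    assume "GammaL_equiv (psi q t m h s) (psi q t \<mu> 1 l)"
    then have equiv: "GammaL_equiv (psi q t \<mu> 1 l) (psi q t m h s)" by (rule GammaL_equiv_sym)
    have one: "N_qt q t 1 = (1 :: 'a)" "1 * frob l (frob l 1) \<noteq> - 1"
      using minus_one_neq_one by (auto simp: N_qt_eq frob_hom)
    obtain \<theta> lam lam' e where \<theta>: "field_automorphism \<theta>" and "lam' \<noteq> 0"
      and lam: "frob t lam * (frob s h * frob (s * (2 * t - 1)) h) = - lam"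
      and lam': "frob t lam' * (frob l 1 * frob (l * (2 * t - 1)) 1) = - 1 * lam'"
      and e: "e \<in> E" "e \<noteq> 0" "\<theta> lam' = e * lam \<or> \<theta> lam' * lam = e"
      by (rule psi_equiv_invariants[OF assms(3) s l h(1,4) m(1,2) disjI1[OF refl] one \<mu>[unfolded subfield_eq_E] equiv])
    have "frob t lam' = - lam'" using lam' by (simp add: frob_hom)
    then have tau: "frob t (\<theta> lam') = - \<theta> lam'"
      using automorphism_frob[OF \<theta>, of t lam'] automorphism_hom(5)[OF \<theta>] by simp
    have image_nz: "\<theta> lam' \<noteq> 0" using \<open>lam' \<noteq> 0\<close> automorphism_hom(8)[OF \<theta>, of lam'] by simp
    then have lam_nz: "lam \<noteq> 0" using e(2,3) by (metis mult_zero_right)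
    have te: "frob t e = e" using e(1) by (simp add: E_def)
    have "frob t lam = - lam"
    proof (cases "\<theta> lam' = e * lam")
      case True
      then have "e * frob t lam = e * - lam" using tau te by (simp add: frob_hom)
      then show ?thesis using e(2) by (metis mult_cancel_left)
    next
      case False
      then have prod: "\<theta> lam' * lam = e" using e(3) by blast
      then have "frob t (\<theta> lam' * lam) = \<theta> lam' * lam" using te by simp
      then have "\<theta> lam' * - frob t lam = \<theta> lam' * lam" using tau by (simp add: frob_hom)
      then have "- frob t lam = lam" using image_nz by (metis mult_cancel_left)
      then show ?thesis by (metis minus_minus)
    qed
    then have "lam * (frob s h * frob (s * (2 * t - 1)) h) = lam * 1" using lam by simp
    then have "frob s h * frob (s * (2 * t - 1)) h = 1" using lam_nz by (metis mult_cancel_left)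
    then have "frob s (frob s h * frob (s * (2 * t - 1)) h) = 1" by (simp add: frob_hom)
    then have "frob s (frob s h) * frob (s + s * (2 * t - 1)) h = 1" by (simp add: frob_hom frob_frob)
    moreover have "s + s * (2 * t - 1) = 0 + 2 * t * s"
      using assms(3) by (cases t) (auto simp: algebra_simps)
    ultimately have "frob s (frob s h) * h = 1" using frob_period[of 0 s h] by (simp add: frob_0)
    then show False using h(3) by (simp add: mult.commute)
  qed
  ultimately show ?thesis
    by (intro exI[of _ m] exI[of _ h] conjI allI impI ballI) simp_all
qed

end
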